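(* Let $0<\alpha<1$. Given $\epsilon>0$ there exists $c>0$ such that for all large enough $n$, $$\pi_n(\mathcal{G}_\epsilon)\ \ge\ 1-e^{-cn},$$ where $\pi_n$ is the stationary distribution of the competitive erosion chain on $\mathrm{Cyl}_n$ and $$\mathcal{G}_\epsilon=\bigl\{\sigma\in\Omega:\ |\sigma^{-1}(1)\,\triangle\,\{(x,y)\in\mathrm{Cyl}_n: y\le\alpha\}|\le\epsilon n^2\bigr\},$$ with $\triangle$ the symmetric difference of sets.
   Context: Fix $\alpha\in(0,1)$. For an integer $n\ge 2$ let $C_n=(\frac1n\mathbb{Z})/\mathbb{Z}$, $P_n=(\frac1n\mathbb{Z})\cap[0,1]$, and let $\mathrm{Cyl}_n=C_n\times P_n$ (with $n(n+1)$ vertices $(x,y)$; $y$ is the height), with edges joining $(x,y)$ to $(x\pm\frac1n,y)$ and to $(x,y\pm\frac1n)$ (when the height stays in $[0,1]$), and one self-loop added at each vertex of height $0$ or $1$, so that the graph is $4$-regular (for $n=2$ horizontal edges are doubled). Simple random walk traverses at each step one of the four edges at its current vertex, chosen uniformly. Configurations are maps $\sigma:\mathrm{Cyl}_n\to\{1,2\}$; color $1$ is "blue", color $2$ is "red". $\Omega$ is the set of configurations with exactly $\lfloor\alpha n(n+1)\rfloor$ blue vertices. Competitive erosion is the Markov chain $(\sigma_t)_{t=0,1,2,\dots}$ on $\Omega$ defined as follows. Given $\sigma_t$, start a simple random walk at a uniform vertex of $C_n\times\{0\}$, run it to the first visited vertex (time $0$ included) that is red in $\sigma_t$, and recolor that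 vertex blue; this gives $\sigma_{t+1/2}$. Then start an independent simple random walk at a uniform vertex of $C_n\times\{1\}$, run it to the first visited vertex (time $0$ included) that is blue in $\sigma_{t+1/2}$, and recolor that vertex red; this gives $\sigma_{t+1}$. All walks are independent. This chain has exactly one recurrent class, hence a unique stationary distribution $\pi_n$. *)

theory Defs
  imports "HOL-Probability.Probability"
begin

text \<open>
  The pair \<open>(i, j)\<close> with \<open>i < n\<close> and \<open>j \<le> n\<close> stands for the point \<open>(i/n mod 1, j/n)\<close> of the
  cylinder, so its height is \<open>j/n\<close>.
\<close>

type_synonym vertex = "nat \<times> nat"

definition Cyl :: "nat \<Rightarrow> vertex set" where
  "Cyl n = {..<n} \<times> {..n}"

definition height :: "nat \<Rightarrow> vertex \<Rightarrow> real" where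
  "height n v = real (snd v) / real n"

text \<open>
  The four edges at a vertex are indexed by a move.  At the bottom (top) row the move \<open>South\<close>
  (\<open>North\<close>) is the self-loop; for \<open>n = 2\<close> the moves \<open>East\<close> and \<open>West\<close> are the two parallel
  horizontal edges.
\<close>

datatype move = East | West | North | South

fun nbr :: "nat \<Rightarrow> vertex \<Rightarrow> move \<Rightarrow> vertex" where
  "nbr n (i, j) East = ((i + 1) mod n, j)"
| "nbr n (i, j) West = ((i + n - 1) mod n, j)"
| "nbr n (i, j) North = (i, if j < n then j + 1 else j)"
| "nbr n (i, j) South = (i, if 0 < j then j - 1 else j)"

primrec walk :: "nat \<Rightarrow> vertex \<Rightarrow> move stream \<Rightarrow> nat \<Rightarrow> vertex" where
  "walk n v \<omega> 0 = v"
| "walk n v \<omega> (Suc t) = nbr n (walk n v \<omega> t) (\<omega> !! t)"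

text \<open>
  If the walk never visits \<open>A\<close> the value is junk; for nonempty \<open>A \<subseteq> Cyl n\<close> and a start in
  \<open>Cyl n\<close> this happens with probability 0.
\<close>

definition first_visit :: "nat \<Rightarrow> vertex set \<Rightarrow> vertex \<Rightarrow> move stream \<Rightarrow> vertex" where
  "first_visit n A v \<omega> = walk n v \<omega> (LEAST t. walk n v \<omega> t \<in> A)"

text \<open>Joint law of a uniform starting column and an independent sequence of uniform moves.\<close>

definition walk_space :: "nat \<Rightarrow> (nat \<times> move stream) measure" where
  "walk_space n =
     measure_pmf (pmf_of_set {..<n}) \<Otimes>\<^sub>M
     stream_space (measure_pmf (pmf_of_set {East, West, North, South}))"

text \<open>Colors: 1 is blue, 2 is red.  Configurations are \<open>undefined\<close> outside the cylinder.\<close>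

type_synonym config = "vertex \<Rightarrow> nat"

definition Omega :: "real \<Rightarrow> nat \<Rightarrow> config set" where
  "Omega \<alpha> n = {\<sigma> \<in> Cyl n \<rightarrow>\<^sub>E {1, 2}.
     int (card {v \<in> Cyl n. \<sigma> v = 1}) = \<lfloor>\<alpha> * real n * (real n + 1)\<rfloor>}"

definition blue_step :: "nat \<Rightarrow> config \<Rightarrow> nat \<times> move stream \<Rightarrow> config" where
  "blue_step n \<sigma> = (\<lambda>(x, \<omega>). \<sigma>(first_visit n {v \<in> Cyl n. \<sigma> v = 2} (x, 0) \<omega> := 1))"

definition red_step :: "nat \<Rightarrow> config \<Rightarrow> nat \<times> move stream \<Rightarrow> config" where
  "red_step n \<sigma> = (\<lambda>(x, \<omega>). \<sigma>(first_visit n {v \<in> Cyl n. \<sigma> v = 1} (x, n) \<omega> := 2))"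

definition trans_prob :: "nat \<Rightarrow> config \<Rightarrow> config \<Rightarrow> real" where
  "trans_prob n \<sigma> \<tau> =
     \<P>(z in walk_space n \<Otimes>\<^sub>M walk_space n.
        red_step n (blue_step n \<sigma> (fst z)) (snd z) = \<tau>)"

definition stationary :: "real \<Rightarrow> nat \<Rightarrow> config pmf \<Rightarrow> bool" where
  "stationary \<alpha> n p \<longleftrightarrow>
     set_pmf p \<subseteq> Omega \<alpha> n \<and>
     (\<forall>\<tau>\<in>Omega \<alpha> n. pmf p \<tau> = (\<Sum>\<sigma>\<in>Omega \<alpha> n. pmf p \<sigma> * trans_prob n \<sigma> \<tau>))"

definition good :: "real \<Rightarrow> real \<Rightarrow> nat \<Rightarrow> config set" where
  "good \<epsilon> \<alpha> n = {\<sigma> \<in> Omega \<alpha> n.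
     real (card (sym_diff {v \<in> Cyl n. \<sigma> v = 1} {v \<in> Cyl n. height n v \<le> \<alpha>}))
       \<le> \<epsilon> * real n ^ 2}"

end

theory Submission
  imports Defs "HOL-Real_Asymp.Real_Asymp"
begin

text \<open>
  Let \<open>B\<close> be the blue set and \<open>u v\<close> the mean height at which a walk from \<open>v\<close> first meets a red
  vertex. The function \<open>w = u - height\<close> vanishes on red vertices, is harmonic on blue ones away from
  the two boundary rows and has a source of total mass 1 at the bottom. Hence its positive part
  \<open>g\<close> has Dirichlet energy at most \<open>D\<close>, the mean of \<open>g\<close> over the bottom row, which is also the
  mean height of the vertex that the blue walk recolors. Since \<open>D\<close> is in turn the average downward
  slope of \<open>g\<close>, and only edges whose lower end is blue contribute positively to it, completing the
  square gives \<open>D \<le> |B| / n\<^sup>2\<close>, with a deficit that bounds the \<open>L\<^sup>2\<close> distance of the gradient of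
  \<open>g\<close> from \<open>(0, - indicator B)\<close>. A small deficit therefore forces \<open>g\<close> to depend on the height only
  and \<open>B\<close> to be close to a slab.

  Turning the cylinder upside down, the red walk recolors a vertex of mean height at least
  \<open>1 - |R| / n\<^sup>2\<close>, where \<open>R\<close> is the red set. So the total height of the blue vertices never has drift
  above \<open>1 / n\<close>, and it has negative drift, bounded away from 0, unless \<open>B\<close> is near the slab. Up to a
  constant this total height is the sum of \<open>|height - \<alpha>|\<close> over the symmetric difference of \<open>B\<close> and the
  slab. Its exponential is then a Lyapunov function whose stationary mean is controlled, and Markov's
  inequality finishes the proof.
\<close>

section \<open>Dirichlet energy on the cylinder\<close>

lemma cyc_succ_pred:
  assumes "i < n" shows "((i + n - 1) mod n + 1) mod n = (i::nat)" "((i + 1) mod n + n - 1) mod n = i"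
proof -
  show "((i + n - 1) mod n + 1) mod n = i"
  proof (cases i)
    case 0 then show ?thesis using assms by simp
  next
    case (Suc k)
    then have "i + n - 1 = k + n" by simp
    then show ?thesis using assms Suc by simp
  qed
  show "((i + 1) mod n + n - 1) mod n = i"
  proof (cases "i + 1 = n")
    case True then show ?thesis using assms by simp
  next
    case False
    then have "(i + 1) mod n = i + 1" using assms by simp
    then show ?thesis using assms by simp
  qed
qed

lemma sum_cyc_succ:
  fixes F :: "nat \<Rightarrow> real"
  shows "(\<Sum>i<n. F ((i + 1) mod n)) = (\<Sum>i<n. F i)"
  by (rule sum.reindex_bij_witness[where i = "\<lambda>i. (i + n - 1) mod n" and j = "\<lambda>i. (i + 1) mod n"])
     (auto simp: cyc_succ_pred[simplified])

text \<open>Green's identity on a cycle: shifting the index by one turns the backward differences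
  into forward ones, and no boundary term arises.\<close>

lemma row_by_parts:
  fixes f g :: "nat \<Rightarrow> real"
  shows "(\<Sum>i<n. g i * ((f i - f ((i + 1) mod n)) + (f i - f ((i + n - 1) mod n))))
    = (\<Sum>i<n. (g ((i + 1) mod n) - g i) * (f ((i + 1) mod n) - f i))"
proof -
  have "(\<Sum>i<n. g i * (f i - f ((i + n - 1) mod n)))
      = (\<Sum>i<n. g ((i + 1) mod n) * (f ((i + 1) mod n) - f (((i + 1) mod n + n - 1) mod n)))"
    by (rule sum_cyc_succ[where F = "\<lambda>i. g i * (f i - f ((i + n - 1) mod n))", symmetric])
  also have "\<dots> = (\<Sum>i<n. g ((i + 1) mod n) * (f ((i + 1) mod n) - f i))"
    by (intro sum.cong refl) (simp add: cyc_succ_pred(2)[simplified])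
  finally have "(\<Sum>i<n. g i * ((f i - f ((i + 1) mod n)) + (f i - f ((i + n - 1) mod n))))
      = (\<Sum>i<n. g i * (f i - f ((i + 1) mod n))) + (\<Sum>i<n. g ((i + 1) mod n) * (f ((i + 1) mod n) - f i))"
    by (simp only: sum.distrib distrib_left)
  then show ?thesis
    unfolding sum.distrib[symmetric] by (simp add: algebra_simps)
qed

text \<open>The conditionals encode the self-loops. A loop contributes a zero difference, a discrete
  Neumann condition, so Green's identity has no boundary term here either.\<close>

lemma column_by_parts:
  fixes f g :: "nat \<Rightarrow> real"
  shows "(\<Sum>j\<le>n. g j * ((f j - f (if j < n then j + 1 else j)) + (f j - f (if 0 < j then j - 1 else j))))
    = (\<Sum>j<n. (g j - g (Suc j)) * (f j - f (Suc j)))"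
proof -
  have "(\<Sum>j\<le>n. g j * (f j - f (if j < n then j + 1 else j))) = (\<Sum>j<n. g j * (f j - f (Suc j)))"
    by (simp add: lessThan_Suc_atMost[symmetric])
  moreover have "(\<Sum>j\<le>n. g j * (f j - f (if 0 < j then j - 1 else j)))
      = (\<Sum>j<n. g (Suc j) * (f (Suc j) - f j))"
    by (simp add: lessThan_Suc_atMost[symmetric] sum.lessThan_Suc_shift del: sum.lessThan_Suc)
  ultimately have "(\<Sum>j\<le>n. g j * ((f j - f (if j < n then j + 1 else j)) + (f j - f (if 0 < j then j - 1 else j))))
    = (\<Sum>j<n. g j * (f j - f (Suc j))) + (\<Sum>j<n. g (Suc j) * (f (Suc j) - f j))"
    by (simp only: sum.distrib distrib_left)
  then show ?thesis
    unfolding sum.distrib[symmetric] by (simp add: algebra_simps)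
qed

lemma sum_Cyl: "(\<Sum>v\<in>Cyl n. F v) = (\<Sum>i<n. \<Sum>j\<le>n. F (i, j))"
  by (simp add: Cyl_def sum.cartesian_product)

lemma finite_Cyl [simp]: "finite (Cyl n)"
  by (simp add: Cyl_def)

lemma nbr_in_Cyl: "v \<in> Cyl n \<Longrightarrow> nbr n v m \<in> Cyl n"
  by (cases v; cases m) (auto simp: Cyl_def)

section \<open>Energy estimates for an abstract stopped height\<close>

text \<open>Collects what the energy argument uses about the mean height \<open>u\<close> at which a
  walk first meets its target \<open>A\<close>. Leaving probability out allows a second, reflected
  instance, which handles the red walk. In the boundary rows the harmonicity includes the
  self-loop.\<close>

locale stopped_height =
  fixes n :: nat and A :: "vertex set" and u :: "vertex \<Rightarrow> real"
  assumes n_pos: "n > 0"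
    and A_sub: "A \<subseteq> Cyl n"
    and u_on_A: "\<And>v. v \<in> A \<Longrightarrow> u v = height n v"
    and u_nonneg: "\<And>v. v \<in> Cyl n \<Longrightarrow> 0 \<le> u v"
    and u_le_1: "\<And>v. v \<in> Cyl n \<Longrightarrow> u v \<le> 1"
    and u_harmonic: "\<And>v. v \<in> Cyl n \<Longrightarrow> v \<notin> A \<Longrightarrow>
      u (nbr n v East) + u (nbr n v West) + u (nbr n v North) + u (nbr n v South) = 4 * u v"
begin

definition w :: "vertex \<Rightarrow> real" where "w v = u v - height n v"
text \<open>
  The positive part discards the negative source at the top row: there \<open>u \<le> 1\<close> makes \<open>w\<close> nonpositive.
\<close>
definition g :: "vertex \<Rightarrow> real" where "g v = max 0 (w v)"
definition dv :: "nat \<Rightarrow> nat \<Rightarrow> real" where "dv i j = g (i, j) - g (i, Suc j)"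
definition dh :: "nat \<Rightarrow> nat \<Rightarrow> real" where "dh i j = g ((i + 1) mod n, j) - g (i, j)"
definition bottom_mean :: real where "bottom_mean = (\<Sum>i<n. u (i, 0)) / n"
text \<open>The ideal value of \<open>dv\<close>: unit downward slope over a mesh of
  \<open>1 / n\<close> off \<open>A\<close>, and flat on \<open>A\<close>.\<close>

definition slope :: "vertex \<Rightarrow> real" where "slope v = (if v \<in> A then 0 else 1 / n)"
definition row_mean :: "nat \<Rightarrow> real" where "row_mean j = (\<Sum>i<n. g (i, j)) / n"

lemma g_nonneg: "g v \<ge> 0" by (simp add: g_def)

lemma g_on_A: "v \<in> A \<Longrightarrow> g v = 0" by (simp add: g_def w_def u_on_A)

lemma g_top: "i < n \<Longrightarrow> g (i, n) = 0"
  using u_le_1[of "(i, n)"] n_pos by (simp add: g_def w_def height_def Cyl_def)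

lemma g_bottom: "i < n \<Longrightarrow> g (i, 0) = u (i, 0)"
  using u_nonneg[of "(i, 0)"] by (simp add: g_def w_def height_def Cyl_def)

text \<open>Truncation at 0 is monotone and 1-Lipschitz, so increments of \<open>g\<close> have the
  sign of those of \<open>w\<close> and are no larger in size.\<close>

lemma positive_part_energy: "(g a - g b)\<^sup>2 \<le> (g a - g b) * (w a - w b)"
proof -
  have "(g a - g b) * (w a - w b - (g a - g b)) \<ge> 0"
    by (auto simp: g_def max_def mult_nonpos_nonpos mult_nonneg_nonneg mult_le_0_iff zero_le_mult_iff)
  then show ?thesis by (simp add: power2_eq_square algebra_simps)
qed

text \<open>The height itself is harmonic except in the boundary rows, where the self-loop replaces
  a neighbor and leaves a defect of \<open>1 / n\<close>.\<close>

lemma laplacian_w: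
  assumes "(i, j) \<in> Cyl n" "(i, j) \<notin> A"
  shows "w (nbr n (i, j) East) + w (nbr n (i, j) West) + w (nbr n (i, j) North) + w (nbr n (i, j) South)
     - 4 * w (i, j) = (if j = n then 1 / n else 0) - (if j = 0 then 1 / n else 0)"
  using u_harmonic[OF assms] assms(1) n_pos
  by (auto simp: w_def height_def Cyl_def add_divide_distrib diff_divide_distrib of_nat_diff)

text \<open>Test the negative Laplacian \<open>L\<close> of \<open>w\<close> against
  \<open>g\<close>. By parts this dominates the energy of \<open>g\<close>; since \<open>g\<close>
  vanishes on \<open>A\<close> and on the top row, only the bottom source remains on the other
  side.\<close>

lemma energy_le:
  "(\<Sum>i<n. \<Sum>j<n. (dv i j)\<^sup>2) + (\<Sum>i<n. \<Sum>j\<le>n. (dh i j)\<^sup>2) \<le> bottom_mean"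
proof -
  define L where "L v = 4 * w v - (w (nbr n v East) + w (nbr n v West) + w (nbr n v North) + w (nbr n v South))" for v
  have "(\<Sum>v\<in>Cyl n. g v * L v) = (\<Sum>i<n. \<Sum>j\<le>n. g (i, j) * L (i, j))"
    by (simp add: sum_Cyl)
  also have "\<dots> = (\<Sum>j\<le>n. \<Sum>i<n. g (i, j) * ((w (i, j) - w ((i + 1) mod n, j)) + (w (i, j) - w ((i + n - 1) mod n, j))))
     + (\<Sum>i<n. \<Sum>j\<le>n. g (i, j) * ((w (i, j) - w (i, if j < n then j + 1 else j)) + (w (i, j) - w (i, if 0 < j then j - 1 else j))))"
    unfolding sum.swap[of _ "{..n}"] sum.distrib[symmetric]
    by (intro sum.cong refl) (simp add: L_def algebra_simps)
  also have "\<dots> = (\<Sum>j\<le>n. \<Sum>i<n. (g ((i + 1) mod n, j) - g (i, j)) * (w ((i + 1) mod n, j) - w (i, j)))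
     + (\<Sum>i<n. \<Sum>j<n. (g (i, j) - g (i, Suc j)) * (w (i, j) - w (i, Suc j)))"
    by (intro arg_cong2[of _ _ _ _ "(+)"] sum.cong refl row_by_parts column_by_parts)
  also have "\<dots> \<ge> (\<Sum>j\<le>n. \<Sum>i<n. (dh i j)\<^sup>2) + (\<Sum>i<n. \<Sum>j<n. (dv i j)\<^sup>2)"
    unfolding dh_def dv_def by (intro add_mono sum_mono positive_part_energy)
  finally have 1: "(\<Sum>j\<le>n. \<Sum>i<n. (dh i j)\<^sup>2) + (\<Sum>i<n. \<Sum>j<n. (dv i j)\<^sup>2) \<le> (\<Sum>v\<in>Cyl n. g v * L v)" .
  have "(\<Sum>v\<in>Cyl n. g v * L v) = (\<Sum>i<n. \<Sum>j\<le>n. if j = 0 then u (i, 0) / n else 0)"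
    unfolding sum_Cyl
  proof (intro sum.cong refl)
    fix i j assume "i \<in> {..<n}" "j \<in> {..n}"
    then have ij: "(i, j) \<in> Cyl n" "i < n" by (auto simp: Cyl_def)
    have "g (i, j) * L (i, j) = (if j = 0 then g (i, 0) / n else 0)"
    proof (cases "(i, j) \<in> A")
      case True then show ?thesis using g_on_A[OF True] by auto
    next
      case False
      have "L (i, j) = (if j = 0 then 1 / n else 0) - (if j = n then 1 / n else 0)"
        using laplacian_w[OF ij(1) False] unfolding L_def by linarith
      then show ?thesis using g_top[OF ij(2)] n_pos by auto
    qed
    then show "g (i, j) * L (i, j) = (if j = 0 then u (i, 0) / n else 0)"
      using g_bottom[OF ij(2)] by simp
  qed
  also have "\<dots> = bottom_mean"
    by (simp add: bottom_mean_def sum_divide_distrib sum.delta)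
  finally show ?thesis using 1 by (subst (2) sum.swap) linarith
qed

lemma sum_dv: "s \<le> n \<Longrightarrow> (\<Sum>i<n. \<Sum>j\<in>{s..<n}. dv i j) = n * row_mean s"
proof -
  assume "s \<le> n"
  have "(\<Sum>j\<in>{s..<n}. dv i j) = g (i, s) - g (i, n)" for i
    using sum_Suc_diff'[OF \<open>s \<le> n\<close>, of "\<lambda>j. - g (i, j)"] by (simp add: dv_def)
  then show ?thesis using n_pos by (simp add: g_top row_mean_def sum_subtractf)
qed

lemma bottom_mean_eq: "bottom_mean = row_mean 0"
  by (simp add: bottom_mean_def row_mean_def g_bottom)

text \<open>Expanding the square gives energy, plus at most |B| / n^2 where B is the complement of
  \<open>A\<close>, minus twice a cross term. The energy is at most \<open>bottom_mean\<close> and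
  the cross term at least \<open>bottom_mean\<close>.\<close>

lemma dissipation:
  "(\<Sum>i<n. \<Sum>j<n. (dv i j - slope (i, j))\<^sup>2) + (\<Sum>i<n. \<Sum>j\<le>n. (dh i j)\<^sup>2)
     \<le> card (Cyl n - A) / (real n)\<^sup>2 - bottom_mean"
proof -
  have "(\<Sum>i<n. \<Sum>j<n. (slope (i, j))\<^sup>2) \<le> (\<Sum>v\<in>Cyl n. (slope v)\<^sup>2)"
    unfolding sum_Cyl by (intro sum_mono sum_mono2) auto
  also have "\<dots> = (\<Sum>v\<in>Cyl n - A. 1 / (real n)\<^sup>2)"
    by (intro sum.mono_neutral_cong_right) (auto simp: slope_def power_divide)
  finally have a: "(\<Sum>i<n. \<Sum>j<n. (slope (i, j))\<^sup>2) \<le> card (Cyl n - A) / (real n)\<^sup>2" by simp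
  have "bottom_mean = (\<Sum>i<n. \<Sum>j<n. dv i j) / n"
    using sum_dv[of 0] n_pos by (simp add: bottom_mean_eq atLeast0LessThan)
  also have "\<dots> = (\<Sum>i<n. \<Sum>j<n. dv i j / n)" by (simp add: sum_divide_distrib)
  also have "\<dots> \<le> (\<Sum>i<n. \<Sum>j<n. dv i j * slope (i, j))"
  proof (intro sum_mono)
    fix i j
    \<comment> \<open>At a red lower end \<open>g\<close> is 0, so the edge goes up in
      \<open>g\<close>; replacing its weight \<open>1 / n\<close> by 0 only increases the
      sum.\<close>
    have "dv i j \<le> 0" if "(i, j) \<in> A" using that g_nonneg[of "(i, Suc j)"] by (simp add: dv_def g_on_A)
    then show "dv i j / n \<le> dv i j * slope (i, j)" using n_pos by (auto simp: slope_def divide_nonpos_nonneg)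
  qed
  finally have b: "bottom_mean \<le> (\<Sum>i<n. \<Sum>j<n. dv i j * slope (i, j))" .
  have "(\<Sum>i<n. \<Sum>j<n. (dv i j - slope (i, j))\<^sup>2)
     = (\<Sum>i<n. \<Sum>j<n. (dv i j)\<^sup>2) + (\<Sum>i<n. \<Sum>j<n. (slope (i, j))\<^sup>2) - 2 * (\<Sum>i<n. \<Sum>j<n. dv i j * slope (i, j))"
    by (simp add: power2_diff sum.distrib sum_subtractf sum_distrib_left mult.assoc)
  then show ?thesis using a b energy_le by linarith
qed

lemma bottom_mean_le: "bottom_mean \<le> card (Cyl n - A) / (real n)\<^sup>2"
proof -
  have "0 \<le> (\<Sum>i<n. \<Sum>j<n. (dv i j - slope (i, j))\<^sup>2) + (\<Sum>i<n. \<Sum>j\<le>n. (dh i j)\<^sup>2)"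
    by (intro add_nonneg_nonneg sum_nonneg) auto
  then show ?thesis using dissipation by linarith
qed

lemma row_mean_nonneg: "0 \<le> row_mean j"
  by (simp add: row_mean_def sum_nonneg g_nonneg)

lemma row_mean_top: "row_mean n = 0"
  by (simp add: row_mean_def g_top)

lemma row_oscillation:
  assumes "i < n" "i' < n"
  shows "\<bar>g (i, j) - g (i', j)\<bar> \<le> (\<Sum>k<n. \<bar>dh k j\<bar>)"
  using assms
proof (induction i i' rule: linorder_wlog)
  case (le a b)
  have "g (b, j) - g (a, j) = (\<Sum>k\<in>{a..<b}. g (Suc k, j) - g (k, j))"
    using le by (simp add: sum_Suc_diff'[of a b "\<lambda>k. g (k, j)"])
  also have "\<dots> = (\<Sum>k\<in>{a..<b}. dh k j)"
    using le by (intro sum.cong refl) (auto simp: dh_def)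
  finally have "\<bar>g (a, j) - g (b, j)\<bar> \<le> (\<Sum>k\<in>{a..<b}. \<bar>dh k j\<bar>)"
    by (metis abs_minus_commute sum_abs)
  also have "\<dots> \<le> (\<Sum>k<n. \<bar>dh k j\<bar>)"
    using le by (intro sum_mono2) auto
  finally show ?case .
next
  case (sym a b) then show ?case by (simp add: abs_minus_commute)
qed

text \<open>A vertex of \<open>A\<close> pins \<open>g\<close> to 0 somewhere in the row, so the row
  mean is at most the total horizontal variation, and Cauchy-Schwarz turns this into energy.\<close>

lemma row_mean_sq_le:
  assumes "(i, j) \<in> A"
  shows "(row_mean j)\<^sup>2 \<le> n * (\<Sum>k<n. (dh k j)\<^sup>2)"
proof -
  have i: "i < n" using assms A_sub by (auto simp: Cyl_def)
  have "(\<Sum>k<n. g (k, j)) \<le> (\<Sum>k<n. (\<Sum>l<n. \<bar>dh l j\<bar>))"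
    using row_oscillation[OF _ i, of _ j] g_on_A[OF assms] g_nonneg by (intro sum_mono) fastforce
  then have "row_mean j \<le> (\<Sum>l<n. \<bar>dh l j\<bar>)"
    using n_pos by (simp add: row_mean_def divide_simps mult.commute)
  then have "(row_mean j)\<^sup>2 \<le> (\<Sum>l<n. \<bar>dh l j\<bar> * 1)\<^sup>2"
    using row_mean_nonneg by (intro power_mono) auto
  also have "\<dots> \<le> (\<Sum>l<n. \<bar>dh l j\<bar>\<^sup>2) * (\<Sum>l<n. 1\<^sup>2)"
    by (rule Cauchy_Schwarz_ineq_sum)
  finally show ?thesis by (simp add: mult.commute)
qed

text \<open>Below the cut row, vertices of \<open>A\<close> cost horizontal energy because the row
  mean is large. Above it, \<open>g\<close> has little left to lose, so few vertices can carry
  slope. The cube leaves one factor \<eta> after dividing by \<eta>^2 in the first count, and yields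
  \<eta>^2 \<le> \<eta> after dividing by \<eta> in the second.\<close>

lemma near_slab:
  fixes \<eta> :: real
  assumes eta: "0 < \<eta>" "\<eta> \<le> 1"
    and small: "card (Cyl n - A) / (real n)\<^sup>2 - bottom_mean \<le> \<eta> ^ 3"
  obtains s where "s \<le> n"
    "card {v \<in> A. snd v < s} \<le> \<eta> * (real n)\<^sup>2"
    "card {v \<in> Cyl n - A. s \<le> snd v} \<le> 3 * \<eta> * (real n)\<^sup>2 + n"
proof -
  \<comment> \<open>The cut is the first row whose mean drops below \<eta>; it exists because the
    top row has mean 0.\<close>
  define s where "s = (LEAST j. row_mean j < \<eta>)"
  have s: "row_mean s < \<eta>" unfolding s_def by (rule LeastI[of _ n]) (use eta row_mean_top in simp)
  have s_n: "s \<le> n" unfolding s_def by (rule Least_le) (use eta row_mean_top in simp)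
  have below: "\<eta> \<le> row_mean j" if "j < s" for j using not_less_Least[of j] that s_def by force
  have vert: "(\<Sum>i<n. \<Sum>j<n. (dv i j - slope (i, j))\<^sup>2) \<le> \<eta> ^ 3"
    and hor: "(\<Sum>i<n. \<Sum>j\<le>n. (dh i j)\<^sup>2) \<le> \<eta> ^ 3"
  proof -
    have "0 \<le> (\<Sum>i<n. \<Sum>j<n. (dv i j - slope (i, j))\<^sup>2)" "0 \<le> (\<Sum>i<n. \<Sum>j\<le>n. (dh i j)\<^sup>2)"
      by (intro sum_nonneg; simp)+
    then show "(\<Sum>i<n. \<Sum>j<n. (dv i j - slope (i, j))\<^sup>2) \<le> \<eta> ^ 3" "(\<Sum>i<n. \<Sum>j\<le>n. (dh i j)\<^sup>2) \<le> \<eta> ^ 3"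
      using dissipation small by linarith+
  qed
  have fin: "finite A" using A_sub finite_Cyl finite_subset by blast
  \<comment> \<open>Each red vertex below the cut charges the horizontal energy of its row, and each
    row is charged at most \<open>n\<close> times.\<close>
  have "\<eta>\<^sup>2 * card {v \<in> A. snd v < s} = (\<Sum>v\<in>{v \<in> A. snd v < s}. \<eta>\<^sup>2)" by simp
  also have "\<dots> \<le> (\<Sum>v\<in>{v \<in> A. snd v < s}. n * (\<Sum>k<n. (dh k (snd v))\<^sup>2))"
  proof (rule sum_mono)
    fix v assume "v \<in> {v \<in> A. snd v < s}"
    then obtain i j where v: "v = (i, j)" "(i, j) \<in> A" "j < s" by (cases v) auto
    have "\<eta>\<^sup>2 \<le> (row_mean j)\<^sup>2" using below[OF v(3)] eta by (intro power_mono) auto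
    then show "\<eta>\<^sup>2 \<le> n * (\<Sum>k<n. (dh k (snd v))\<^sup>2)" using row_mean_sq_le[OF v(2)] v(1) by simp
  qed
  also have "\<dots> \<le> (\<Sum>v\<in>Cyl n. n * (\<Sum>k<n. (dh k (snd v))\<^sup>2))"
    using A_sub by (intro sum_mono2) (auto intro!: mult_nonneg_nonneg sum_nonneg)
  also have "\<dots> = (real n)\<^sup>2 * (\<Sum>k<n. \<Sum>j\<le>n. (dh k j)\<^sup>2)"
    unfolding sum_Cyl sum.swap[of "\<lambda>k j. (dh k j)\<^sup>2"]
    by (simp add: sum_distrib_left power2_eq_square mult.assoc)
  also have "\<dots> \<le> (real n)\<^sup>2 * \<eta> ^ 3" using hor by (intro mult_left_mono) auto
  also have "\<dots> = \<eta>\<^sup>2 * (\<eta> * (real n)\<^sup>2)" by (simp add: power2_eq_square power3_eq_cube)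
  finally have red: "card {v \<in> A. snd v < s} \<le> \<eta> * (real n)\<^sup>2" using eta by simp

  \<comment> \<open>AM-GM, traded against the quadratic deficit so that no square roots appear\<close>
  have amgm: "slope (i, j) - dv i j \<le> \<eta> / n + n / \<eta> * (dv i j - slope (i, j))\<^sup>2" for i j
  proof -
    define x where "x = dv i j - slope (i, j)"
    have "0 \<le> (n * x + \<eta>)\<^sup>2 + (n * x)\<^sup>2 + \<eta>\<^sup>2" by simp
    then have "- 2 * n * x * \<eta> \<le> 2 * (n * x)\<^sup>2 + 2 * \<eta>\<^sup>2" by (simp add: power2_eq_square algebra_simps)
    then have "- x \<le> \<eta> / n + n / \<eta> * x\<^sup>2" using eta n_pos by (simp add: divide_simps power2_eq_square algebra_simps)
    then show ?thesis by (simp add: x_def)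
  qed
  \<comment> \<open>The part of the slope sum accounted for by \<open>dv\<close> telescopes to the
    row mean at the cut, which is below \<eta>; the rest is the deficit.\<close>
  have "(\<Sum>i<n. \<Sum>j\<in>{s..<n}. slope (i, j)) = (\<Sum>i<n. \<Sum>j\<in>{s..<n}. slope (i, j) - dv i j) + n * row_mean s"
    by (simp add: sum_subtractf sum_dv[OF s_n])
  also have "\<dots> \<le> (\<Sum>i<n. \<Sum>j<n. \<eta> / n + n / \<eta> * (dv i j - slope (i, j))\<^sup>2) + n * \<eta>"
  proof (intro add_mono sum_mono)
    fix i
    have "(\<Sum>j\<in>{s..<n}. slope (i, j) - dv i j) \<le> (\<Sum>j\<in>{s..<n}. \<eta> / n + n / \<eta> * (dv i j - slope (i, j))\<^sup>2)"
      by (intro sum_mono amgm)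
    also have "\<dots> \<le> (\<Sum>j<n. \<eta> / n + n / \<eta> * (dv i j - slope (i, j))\<^sup>2)"
      using eta by (intro sum_mono2) auto
    finally show "(\<Sum>j\<in>{s..<n}. slope (i, j) - dv i j) \<le> (\<Sum>j<n. \<eta> / n + n / \<eta> * (dv i j - slope (i, j))\<^sup>2)" .
  qed (use s n_pos in simp)
  also have "\<dots> = n * \<eta> + n / \<eta> * (\<Sum>i<n. \<Sum>j<n. (dv i j - slope (i, j))\<^sup>2) + n * \<eta>"
    using n_pos by (simp add: sum.distrib sum_distrib_left)
  also have "\<dots> \<le> n * \<eta> + n / \<eta> * \<eta> ^ 3 + n * \<eta>"
    using vert eta by (intro add_mono mult_left_mono) auto
  also have "n / \<eta> * \<eta> ^ 3 = n * (\<eta> * \<eta>)" using eta by (simp add: power3_eq_cube)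
  also have "\<dots> \<le> n * (\<eta> * 1)" using eta by (intro mult_left_mono) auto
  finally have sl: "(\<Sum>i<n. \<Sum>j\<in>{s..<n}. slope (i, j)) \<le> 3 * n * \<eta>" by (simp add: mult.commute)
  \<comment> \<open>The slopes stop below the top row, so that row is left out here and added back
    as the error term \<open>n\<close>.\<close>
  define C where "C = {v \<in> Cyl n - A. s \<le> snd v \<and> snd v < n}"
  have finC: "finite C" unfolding C_def by simp
  have "card C / n = (\<Sum>v\<in>{..<n} \<times> {s..<n}. slope v)"
  proof -
    have "(\<Sum>v\<in>{..<n} \<times> {s..<n}. slope v) = (\<Sum>v\<in>C. 1 / n)"
      by (intro sum.mono_neutral_cong_right) (auto simp: slope_def C_def Cyl_def)
    then show ?thesis by simp
  qed
  also have "\<dots> \<le> 3 * n * \<eta>" using sl by (simp add: sum.cartesian_product)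
  finally have "card C \<le> 3 * \<eta> * (real n)\<^sup>2" using n_pos by (simp add: divide_simps power2_eq_square algebra_simps)
  moreover have "card {v \<in> Cyl n - A. s \<le> snd v} \<le> card (C \<union> {..<n} \<times> {n})"
    using finC by (intro card_mono) (auto simp: C_def Cyl_def)
  moreover have "card (C \<union> {..<n} \<times> {n}) \<le> card C + n"
    using card_Un_le[of C "{..<n} \<times> {n}"] by (simp add: card_cartesian_product)
  ultimately have "card {v \<in> Cyl n - A. s \<le> snd v} \<le> 3 * \<eta> * (real n)\<^sup>2 + n" by linarith
  with s_n red show ?thesis by (rule that)
qed

end

section \<open>Comparison with the level set\<close>

text \<open>The slab consists of \<open>nat \<lfloor>\<alpha> * n\<rfloor> + 1\<close> full rows,
  the 1 coming from row 0.\<close>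

lemma card_slab:
  fixes \<alpha> :: real
  assumes "0 < \<alpha>" "\<alpha> < 1" "n > 0"
  shows "\<alpha> * (real n)\<^sup>2 \<le> card {v \<in> Cyl n. height n v \<le> \<alpha>}"
    and "card {v \<in> Cyl n. height n v \<le> \<alpha>} \<le> \<alpha> * (real n)\<^sup>2 + n"
proof -
  have "\<alpha> * n \<le> 1 * real n" using assms by (intro mult_right_mono) auto
  then have le_n: "nat \<lfloor>\<alpha> * n\<rfloor> \<le> n" by linarith
  have "height n (i, j) \<le> \<alpha> \<longleftrightarrow> j \<le> nat \<lfloor>\<alpha> * n\<rfloor>" for i j
  proof -
    have "height n (i, j) \<le> \<alpha> \<longleftrightarrow> real j \<le> \<alpha> * n" using assms by (simp add: height_def divide_simps)
    also have "\<dots> \<longleftrightarrow> int j \<le> \<lfloor>\<alpha> * n\<rfloor>" by (simp add: le_floor_iff)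
    also have "\<dots> \<longleftrightarrow> j \<le> nat \<lfloor>\<alpha> * n\<rfloor>" using assms by (auto simp: le_nat_iff)
    finally show ?thesis .
  qed
  then have "{v \<in> Cyl n. height n v \<le> \<alpha>} = {..<n} \<times> {..nat \<lfloor>\<alpha> * n\<rfloor>}"
    using le_n by (auto simp: Cyl_def)
  then have card: "real (card {v \<in> Cyl n. height n v \<le> \<alpha>}) = n * (nat \<lfloor>\<alpha> * n\<rfloor> + 1)"
    by (simp add: card_cartesian_product)
  have "0 \<le> \<alpha> * n" using assms by simp
  then have "\<alpha> * n \<le> real (nat \<lfloor>\<alpha> * n\<rfloor>) + 1" "real (nat \<lfloor>\<alpha> * n\<rfloor>) \<le> \<alpha> * n"
    by linarith+
  then have "n * (\<alpha> * n) \<le> n * (real (nat \<lfloor>\<alpha> * n\<rfloor>) + 1)" "n * (real (nat \<lfloor>\<alpha> * n\<rfloor>) + 1) \<le> n * (\<alpha> * n + 1)"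
    by (intro mult_left_mono; simp)+
  then show "\<alpha> * (real n)\<^sup>2 \<le> card {v \<in> Cyl n. height n v \<le> \<alpha>}"
    "card {v \<in> Cyl n. height n v \<le> \<alpha>} \<le> \<alpha> * (real n)\<^sup>2 + n"
    unfolding card by (simp_all add: power2_eq_square algebra_simps)
qed

lemma card_diff_le_sym_diff:
  assumes "finite X" "finite Y"
  shows "real (card X) - card Y \<le> card (sym_diff X Y)"
proof -
  have "card X \<le> card (Y \<union> sym_diff X Y)" using assms by (intro card_mono) auto
  also have "\<dots> \<le> card Y + card (sym_diff X Y)" by (rule card_Un_le)
  finally show ?thesis by simp
qed

context stopped_height
begin

text \<open>The cut row of \<open>near_slab\<close> is not known to be near \<alpha>, but the volume
  constraint fixes it: two slabs are nested, so their distance is their difference in size.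
  Distances 4\<eta>n^2 + n to \<open>T\<close> and 4\<eta>n^2 + 3n from \<open>T\<close> to
  \<open>S\<close> add up to the bound.\<close>

lemma near_level_set:
  fixes \<eta> \<alpha> :: real
  assumes eta: "0 < \<eta>" "\<eta> \<le> 1"
    and small: "card (Cyl n - A) / (real n)\<^sup>2 - bottom_mean \<le> \<eta> ^ 3"
    and alpha: "0 < \<alpha>" "\<alpha> < 1"
    and vol: "\<bar>card (Cyl n - A) - \<alpha> * n * (real n + 1)\<bar> \<le> 1"
  shows "card (sym_diff (Cyl n - A) {v \<in> Cyl n. height n v \<le> \<alpha>}) \<le> 8 * \<eta> * (real n)\<^sup>2 + 4 * real n"
proof -
  define B where "B = Cyl n - A"
  define S where "S = {v \<in> Cyl n. height n v \<le> \<alpha>}"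
  obtain s where s: "s \<le> n" "card {v \<in> A. snd v < s} \<le> \<eta> * (real n)\<^sup>2"
    "card {v \<in> Cyl n - A. s \<le> snd v} \<le> 3 * \<eta> * (real n)\<^sup>2 + n"
    by (rule near_slab[OF eta small])
  define T where "T = {v \<in> Cyl n. snd v < s}"
  have fin: "finite B" "finite S" "finite T" by (auto simp: B_def S_def T_def)
  have "sym_diff B T \<subseteq> {v \<in> A. snd v < s} \<union> {v \<in> Cyl n - A. s \<le> snd v}"
    by (auto simp: B_def T_def)
  then have "card (sym_diff B T) \<le> card ({v \<in> A. snd v < s} \<union> {v \<in> Cyl n - A. s \<le> snd v})"
    using A_sub finite_subset[OF A_sub] by (intro card_mono) auto
  also have "\<dots> \<le> card {v \<in> A. snd v < s} + card {v \<in> Cyl n - A. s \<le> snd v}"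
    by (rule card_Un_le)
  finally have BT: "card (sym_diff B T) \<le> 4 * \<eta> * (real n)\<^sup>2 + n" using s(2,3) by linarith
  have "S \<subseteq> T \<or> T \<subseteq> S"
  proof (rule ccontr)
    assume "\<not> (S \<subseteq> T \<or> T \<subseteq> S)"
    then obtain a b where "a \<in> S" "a \<notin> T" "b \<in> T" "b \<notin> S" by blast
    then have "s \<le> snd a" "snd b < s" "height n a \<le> \<alpha>" "\<alpha> < height n b" by (auto simp: S_def T_def)
    moreover from this have "height n b \<le> height n a" by (simp add: height_def divide_right_mono)
    ultimately show False by linarith
  qed
  then have TS: "card (sym_diff T S) = \<bar>real (card T) - card S\<bar>"
  proof
    assume "S \<subseteq> T"
    then have "sym_diff T S = T - S" by auto
    with \<open>S \<subseteq> T\<close> fin show ?thesis by (simp add: card_Diff_subset card_mono of_nat_diff)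
  next
    assume "T \<subseteq> S"
    then have "sym_diff T S = S - T" by auto
    with \<open>T \<subseteq> S\<close> fin show ?thesis by (simp add: card_Diff_subset card_mono of_nat_diff)
  qed
  have "sym_diff T B = sym_diff B T" by auto
  then have "\<bar>real (card T) - card B\<bar> \<le> card (sym_diff B T)"
    using card_diff_le_sym_diff[OF fin(3,1)] card_diff_le_sym_diff[OF fin(1,3)] by simp
  \<comment> \<open>The errors are \<alpha>n from the extra row in n(n+1), at most n from rounding
    the slab to rows, and 1 from the floor in the volume.\<close>
  moreover have "\<bar>real (card B) - card S\<bar> \<le> 2 * n"
  proof -
    have "\<alpha> * n \<le> 1 * real n" "0 \<le> \<alpha> * n" using alpha by (intro mult_right_mono mult_nonneg_nonneg; simp)+
    moreover have "\<alpha> * n * (real n + 1) = \<alpha> * (real n)\<^sup>2 + \<alpha> * n" by (simp add: power2_eq_square algebra_simps)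
    moreover have "1 \<le> real n" using n_pos by simp
    ultimately show ?thesis using vol card_slab[OF alpha n_pos] unfolding B_def[symmetric] S_def[symmetric]
      by (simp only: of_nat_mult of_nat_numeral)
  qed
  ultimately have "card (sym_diff T S) \<le> card (sym_diff B T) + 2 * real n" unfolding TS by linarith
  moreover have "card (sym_diff B S) \<le> card (sym_diff B T \<union> sym_diff T S)"
    using fin by (intro card_mono) auto
  moreover have "\<dots> \<le> card (sym_diff B T) + card (sym_diff T S)" by (rule card_Un_le)
  ultimately show ?thesis using BT unfolding B_def[symmetric] S_def[symmetric] by linarith
qed

end

section \<open>Reflection of the cylinder and the walk from the top\<close>

definition flip :: "nat \<Rightarrow> vertex \<Rightarrow> vertex" where "flip n v = (fst v, n - snd v)"

lemma flip_flip: "v \<in> Cyl n \<Longrightarrow> flip n (flip n v) = v"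
  by (auto simp: flip_def Cyl_def)

lemma flip_in_Cyl: "v \<in> Cyl n \<Longrightarrow> flip n v \<in> Cyl n"
  by (auto simp: flip_def Cyl_def)

lemma height_flip: "v \<in> Cyl n \<Longrightarrow> n > 0 \<Longrightarrow> height n (flip n v) = 1 - height n v"
  by (auto simp: flip_def Cyl_def height_def of_nat_diff field_simps)

lemma flip_nbr:
  assumes "v \<in> Cyl n"
  shows "flip n (nbr n v East) = nbr n (flip n v) East" "flip n (nbr n v West) = nbr n (flip n v) West"
    "flip n (nbr n v North) = nbr n (flip n v) South" "flip n (nbr n v South) = nbr n (flip n v) North"
  using assms by (cases v; auto simp: flip_def Cyl_def)+

context stopped_height
begin

text \<open>Reflection turns \<open>u\<close> into \<open>1 - u\<close> composed with
  \<open>flip\<close>, which satisfies the same axioms for the reflected target, so the bound at the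
  bottom transfers.\<close>

lemma top_mean_ge:
  "1 - card (Cyl n - A) / (real n)\<^sup>2 \<le> (\<Sum>i<n. u (i, n)) / n"
proof -
  let ?A = "{v \<in> Cyl n. flip n v \<in> A}" and ?u = "\<lambda>v. 1 - u (flip n v)"
  interpret F: stopped_height n ?A ?u
  proof
    show "n > 0" by (rule n_pos)
    show "?u v = height n v" if "v \<in> ?A" for v
      using that u_on_A[of "flip n v"] height_flip[of v n] n_pos by auto
    show "0 \<le> ?u v" "?u v \<le> 1" if "v \<in> Cyl n" for v
      using that u_nonneg[OF flip_in_Cyl[OF that]] u_le_1[OF flip_in_Cyl[OF that]] by auto
    show "?u (nbr n v East) + ?u (nbr n v West) + ?u (nbr n v North) + ?u (nbr n v South) = 4 * ?u v"
      if "v \<in> Cyl n" "v \<notin> ?A" for v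
      using that u_harmonic[OF flip_in_Cyl[OF that(1)]] by (simp add: flip_nbr)
  qed auto
  have "bij_betw (flip n) (Cyl n - ?A) (Cyl n - A)"
    by (rule bij_betw_byWitness[where f' = "flip n"]) (auto simp: flip_flip flip_in_Cyl)
  then have "card (Cyl n - ?A) = card (Cyl n - A)" by (rule bij_betw_same_card)
  moreover have "F.bottom_mean = 1 - (\<Sum>i<n. u (i, n)) / n"
    unfolding F.bottom_mean_def using n_pos by (simp add: flip_def sum_subtractf diff_divide_distrib)
  ultimately show ?thesis using F.bottom_mean_le by simp
qed

end

section \<open>First-step analysis of the walk\<close>

abbreviation moves :: "move stream measure" where
  "moves \<equiv> stream_space (measure_pmf (pmf_of_set {East, West, North, South}))"

lemma prob_space_moves: "prob_space moves"
  by (rule prob_space.prob_space_stream_space) (rule measure_pmf.prob_space_axioms)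

lemma prob_space_walk_space: "prob_space (walk_space n)"
  unfolding walk_space_def
  by (rule prob_space_pair) (rule measure_pmf.prob_space_axioms prob_space_moves)+

instance move :: countable
  by (rule countable_classI[of "case_move 0 1 2 (3::nat)"]) (auto split: move.splits)

lemma measurable_walk [measurable]: "(\<lambda>\<omega>. walk n v \<omega> t) \<in> measurable moves (count_space UNIV)"
proof (induction t)
  case (Suc t)
  note Suc[measurable]
  have [measurable]: "(\<lambda>\<omega>. \<omega> !! t) \<in> measurable moves (count_space UNIV)"
    using measurable_snth[of t "measure_pmf (pmf_of_set {East, West, North, South})"] by simp
  have "(\<lambda>\<omega>. (\<lambda>(a, b). nbr n a b) (walk n v \<omega> t, \<omega> !! t)) \<in> measurable moves (count_space UNIV)"
    by measurable
  then show ?case by simp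
qed simp

lemma measurable_first_visit [measurable]:
  "(\<lambda>\<omega>. first_visit n A v \<omega>) \<in> measurable moves (count_space UNIV)"
  unfolding first_visit_def by measurable

lemma measurable_first_visit_start [measurable]:
  "(\<lambda>z. first_visit n A (fst z, j) (snd z)) \<in> measurable (walk_space n) (count_space UNIV)"
  unfolding walk_space_def by measurable

lemma walk_Stream: "walk n v (m ## \<omega>) (Suc t) = walk n (nbr n v m) \<omega> t"
  by (induction t) auto

lemma walk_in_Cyl: "v \<in> Cyl n \<Longrightarrow> walk n v \<omega> t \<in> Cyl n"
  by (induction t) (auto intro: nbr_in_Cyl)

lemma first_visit_in_Cyl: "v \<in> Cyl n \<Longrightarrow> first_visit n A v \<omega> \<in> Cyl n"
  by (simp add: first_visit_def walk_in_Cyl)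

text \<open>The event on which \<open>first_visit\<close> is not a junk value.\<close>

definition visits :: "nat \<Rightarrow> vertex set \<Rightarrow> vertex \<Rightarrow> move stream \<Rightarrow> bool" where
  "visits n A v \<omega> \<longleftrightarrow> (\<exists>t. walk n v \<omega> t \<in> A)"

lemma measurable_visits [measurable]: "Measurable.pred moves (visits n A v)"
  unfolding visits_def by measurable

lemma first_visit_in: "visits n A v \<omega> \<Longrightarrow> first_visit n A v \<omega> \<in> A"
  unfolding visits_def first_visit_def by (rule LeastI_ex)

lemma visits_start: "v \<in> A \<Longrightarrow> visits n A v \<omega>"
  unfolding visits_def by (rule exI[of _ 0]) simp

lemma first_visit_start: "v \<in> A \<Longrightarrow> first_visit n A v \<omega> = v"
proof -
  assume "v \<in> A"
  then have "(LEAST t. walk n v \<omega> t \<in> A) = 0" by (intro Least_eq_0) simp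
  then show ?thesis by (simp add: first_visit_def)
qed

lemma visits_Stream: "v \<notin> A \<Longrightarrow> visits n A v (m ## \<omega>) \<longleftrightarrow> visits n A (nbr n v m) \<omega>"
proof -
  assume v: "v \<notin> A"
  have "(\<exists>t. walk n v (m ## \<omega>) t \<in> A) \<longleftrightarrow> (\<exists>t. walk n v (m ## \<omega>) (Suc t) \<in> A)"
    using v by (metis not0_implies_Suc walk.simps(1))
  then show ?thesis unfolding visits_def walk_Stream .
qed

text \<open>Markov property at time 1: off \<open>A\<close> the time 0 does not count, so the least
  hitting time shifts by one. The visit hypothesis rules out the junk value.\<close>

lemma first_visit_Stream:
  assumes "v \<notin> A" "visits n A (nbr n v m) \<omega>"
  shows "first_visit n A v (m ## \<omega>) = first_visit n A (nbr n v m) \<omega>"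
proof -
  obtain t where "walk n v (m ## \<omega>) t \<in> A"
    using assms visits_Stream visits_def by blast
  then have "(LEAST t. walk n v (m ## \<omega>) t \<in> A) = Suc (LEAST t. walk n v (m ## \<omega>) (Suc t) \<in> A)"
    using assms(1) by (intro Least_Suc) auto
  then show ?thesis by (simp add: first_visit_def walk_Stream del: walk.simps)
qed

text \<open>A stream of independent moves is a uniform move followed by an independent stream of the
  same law. The bounds on \<open>F\<close> give integrability, which transfers the identity from
  nonnegative integrals.\<close>

lemma first_step:
  fixes F :: "move stream \<Rightarrow> real"
  assumes [measurable]: "F \<in> borel_measurable moves"
    and F: "\<And>\<omega>. 0 \<le> F \<omega>" "\<And>\<omega>. F \<omega> \<le> 1"
  shows "4 * (\<integral>\<omega>. F \<omega> \<partial>moves) = (\<integral>\<omega>. F (East ## \<omega>) \<partial>moves) + (\<integral>\<omega>. F (West ## \<omega>) \<partial>moves)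
    + (\<integral>\<omega>. F (North ## \<omega>) \<partial>moves) + (\<integral>\<omega>. F (South ## \<omega>) \<partial>moves)"
proof -
  interpret M: prob_space moves by (rule prob_space_moves)
  let ?p = "pmf_of_set {East, West, North, South}"
  have meas [measurable]: "(\<lambda>\<omega>. F (m ## \<omega>)) \<in> borel_measurable moves" for m
  proof -
    have "(\<lambda>\<omega>. m ## \<omega>) \<in> measurable moves moves" by measurable
    from measurable_compose[OF this assms(1)] show ?thesis .
  qed
  have "ennreal (\<integral>\<omega>. F \<omega> \<partial>moves) = (\<integral>\<^sup>+\<omega>. F \<omega> \<partial>moves)"
    by (intro nn_integral_eq_integral[symmetric] M.integrable_const_bound[of _ 1]) (use F in auto)
  also have "\<dots> = (\<integral>\<^sup>+m. (\<integral>\<^sup>+\<omega>. F (m ## \<omega>) \<partial>moves) \<partial>?p)"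
    by (rule prob_space.nn_integral_stream_space[OF measure_pmf.prob_space_axioms]) measurable
  also have "\<dots> = (\<integral>\<^sup>+m. (\<integral>\<omega>. F (m ## \<omega>) \<partial>moves) \<partial>?p)"
    by (intro nn_integral_cong nn_integral_eq_integral M.integrable_const_bound[of _ 1]) (use F in auto)
  also have "\<dots> = (\<integral>m. (\<integral>\<omega>. F (m ## \<omega>) \<partial>moves) \<partial>?p)"
    by (intro nn_integral_eq_integral integrable_measure_pmf_finite) (auto simp: F)
  finally have "(\<integral>\<omega>. F \<omega> \<partial>moves) = (\<integral>m. (\<integral>\<omega>. F (m ## \<omega>) \<partial>moves) \<partial>?p)"
    by (subst (asm) ennreal_inj) (auto intro!: integral_nonneg_AE simp: F)
  then show ?thesis by (simp add: integral_pmf_of_set)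
qed

section \<open>Almost sure hitting\<close>

text \<open>Irreducibility of the walk: go east along the row to the right column, down to the
  bottom, then up.\<close>

lemma nbr_closed_eq_Cyl:
  assumes "S \<subseteq> Cyl n" "S \<noteq> {}" and closed: "\<And>v m. v \<in> S \<Longrightarrow> nbr n v m \<in> S"
  shows "S = Cyl n"
proof
  obtain i j where ij: "(i, j) \<in> S" using assms(2) by auto
  then have i: "i < n" using assms(1) by (auto simp: Cyl_def)
  \<comment> \<open>Truncated subtraction matches the loop at the bottom, so the descent holds for
    every \<open>k\<close>.\<close>
  have down: "(a, b - k) \<in> S" if "(a, b) \<in> S" for a b k
  proof (induction k)
    case (Suc k)
    have "b - Suc k = b - k - 1" by simp
    then show ?case using closed[OF Suc, of South] Suc by (cases "b - k") auto
  qed (use that in simp)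
  have up: "(a, b) \<in> S" if "(a, 0) \<in> S" "b \<le> n" for a b
    using that(2)
  proof (induction b)
    case (Suc b) then show ?case using closed[of "(a, b)" North] by simp
  qed (use that in simp)
  have east: "((i + k) mod n, j) \<in> S" for k
  proof (induction k)
    case 0 then show ?case using ij i by simp
  next
    case (Suc k) then show ?case using closed[OF Suc, of East] by (simp add: mod_Suc_eq)
  qed
  show "Cyl n \<subseteq> S"
  proof
    fix v assume "v \<in> Cyl n"
    then obtain a b where v: "v = (a, b)" "a < n" "b \<le> n" by (auto simp: Cyl_def)
    have "(i + (a + n - i)) mod n = a" using v i by simp
    then have "(a, j) \<in> S" using east[of "a + n - i"] by simp
    then have "(a, 0) \<in> S" using down[of a j j] by simp
    then show "v \<in> S" using up v by simp
  qed
qed (rule assms(1))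

lemma AE_visits:
  assumes A: "A \<subseteq> Cyl n" "A \<noteq> {}" and v: "v \<in> Cyl n"
  shows "AE \<omega> in moves. visits n A v \<omega>"
proof -
  interpret M: prob_space moves by (rule prob_space_moves)
  \<comment> \<open>The escape probability is harmonic off \<open>A\<close> and 0 on \<open>A\<close>, so the maximum principle applies.\<close>
  define p :: "vertex \<Rightarrow> real" where "p v = (\<integral>\<omega>. indicator {\<omega>. \<not> visits n A v \<omega>} \<omega> \<partial>moves)" for v :: vertex
  have [measurable]: "{\<omega>. \<not> visits n A v \<omega>} \<in> sets moves" for v
  proof -
    have "Measurable.pred moves (\<lambda>\<omega>. \<not> visits n A v \<omega>)" by measurable
    from predE[OF this] show ?thesis by (simp add: space_stream_space)
  qed
  have p_step: "4 * p v = p (nbr n v East) + p (nbr n v West) + p (nbr n v North) + p (nbr n v South)"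
    if "v \<notin> A" for v
  proof -
    have ind: "indicator {\<omega>. \<not> visits n A v \<omega>} (m ## \<omega>) = (indicator {\<omega>. \<not> visits n A (nbr n v m) \<omega>} \<omega> :: real)" for m \<omega>
      using visits_Stream[OF that] by (simp add: indicator_def)
    show ?thesis unfolding p_def by (subst first_step) (simp_all only: ind, auto)
  qed
  have p_A: "p v = 0" if "v \<in> A" for v
    using visits_start[OF that] by (simp add: p_def)
  define M where "M = Max (p ` Cyl n)"
  have M_ge: "p v \<le> M" if "v \<in> Cyl n" for v
    unfolding M_def using that by (intro Max_ge) auto
  have "M \<in> p ` Cyl n" unfolding M_def using v by (intro Max_in) auto
  then obtain v0 where v0: "v0 \<in> Cyl n" "p v0 = M" by auto
  have "M \<le> 0"
  proof (rule ccontr)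
    assume pos: "\<not> M \<le> 0"
    \<comment> \<open>An average of four values at most \<open>M\<close> equals \<open>M\<close>
      only if all four do, so a positive maximum would spread to \<open>A\<close>, where
      \<open>p\<close> is 0.\<close>
    have "{v \<in> Cyl n. p v = M} = Cyl n"
    proof (rule nbr_closed_eq_Cyl)
      fix v m assume "v \<in> {v \<in> Cyl n. p v = M}"
      then have v: "v \<in> Cyl n" "p v = M" by auto
      then have "v \<notin> A" using p_A[of v] pos by auto
      from p_step[OF this] have "p (nbr n v m) = M"
        using v(2) M_ge[OF nbr_in_Cyl[OF v(1)], of East] M_ge[OF nbr_in_Cyl[OF v(1)], of West]
          M_ge[OF nbr_in_Cyl[OF v(1)], of North] M_ge[OF nbr_in_Cyl[OF v(1)], of South]
        by (cases m) simp_all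
      then show "nbr n v m \<in> {v \<in> Cyl n. p v = M}" using nbr_in_Cyl[OF v(1)] by simp
    qed (use v0 in blast)+
    moreover obtain a where "a \<in> A" using A(2) by blast
    ultimately have "p a = M" using A(1) by blast
    then show False using p_A[OF \<open>a \<in> A\<close>] pos by simp
  qed
  then have "p v \<le> 0" using M_ge[OF v] by simp
  then have "measure moves {\<omega>. \<not> visits n A v \<omega>} = 0"
    by (simp add: p_def measure_le_0_iff)
  then show ?thesis
    by (intro AE_I[of _ _ "{\<omega>. \<not> visits n A v \<omega>}"]) (auto simp: M.emeasure_eq_measure)
qed

section \<open>Mean height of the stopped walk\<close>

definition mean_hit :: "nat \<Rightarrow> vertex set \<Rightarrow> vertex \<Rightarrow> real" where
  "mean_hit n A v = (\<integral>\<omega>. height n (first_visit n A v \<omega>) \<partial>moves)"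

lemma height_bounds: "v \<in> Cyl n \<Longrightarrow> 0 \<le> height n v" "v \<in> Cyl n \<Longrightarrow> height n v \<le> 1"
  by (auto simp: height_def Cyl_def divide_le_eq_1)

lemma integrable_mean_hit:
  assumes "v \<in> Cyl n"
  shows "integrable moves (\<lambda>\<omega>. height n (first_visit n A v \<omega>))"
proof -
  interpret M: prob_space moves by (rule prob_space_moves)
  show ?thesis
    using height_bounds[OF first_visit_in_Cyl[OF assms]]
    by (intro M.integrable_const_bound[of _ 1]) auto
qed

lemma mean_hit_bounds:
  assumes "v \<in> Cyl n" shows "0 \<le> mean_hit n A v" "mean_hit n A v \<le> 1"
proof -
  interpret M: prob_space moves by (rule prob_space_moves)
  show "0 \<le> mean_hit n A v"
    unfolding mean_hit_def
    by (intro integral_nonneg_AE AE_I2 height_bounds first_visit_in_Cyl assms)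
  show "mean_hit n A v \<le> 1"
    unfolding mean_hit_def
    by (intro M.integral_le_const integrable_mean_hit AE_I2 height_bounds first_visit_in_Cyl assms)
qed

lemma stopped_height_mean_hit:
  assumes A: "A \<subseteq> Cyl n" "A \<noteq> {}" and n: "n > 0"
  shows "stopped_height n A (mean_hit n A)"
proof
  interpret M: prob_space moves by (rule prob_space_moves)
  show "mean_hit n A v = height n v" if "v \<in> A" for v
    using that by (simp add: mean_hit_def first_visit_start M.prob_space)
  show "mean_hit n A (nbr n v East) + mean_hit n A (nbr n v West) + mean_hit n A (nbr n v North)
      + mean_hit n A (nbr n v South) = 4 * mean_hit n A v" if v: "v \<in> Cyl n" "v \<notin> A" for v
  proof -
    have step: "(\<integral>\<omega>. height n (first_visit n A v (m ## \<omega>)) \<partial>moves) = mean_hit n A (nbr n v m)" for m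
    proof -
      have "(\<lambda>\<omega>. m ## \<omega>) \<in> measurable moves moves" by measurable
      from measurable_compose[OF this measurable_first_visit]
      have [measurable]: "(\<lambda>\<omega>. first_visit n A v (m ## \<omega>)) \<in> measurable moves (count_space UNIV)" .
      show ?thesis
        unfolding mean_hit_def
        \<comment> \<open>The shift identity for \<open>first_visit\<close> fails only when the
          target is never met, a null event.\<close>
        using AE_visits[OF A nbr_in_Cyl[OF v(1), of m]]
        by (intro integral_cong_AE) (auto simp: first_visit_Stream[OF v(2)])
    qed
    have "4 * (\<integral>\<omega>. height n (first_visit n A v \<omega>) \<partial>moves)
      = mean_hit n A (nbr n v East) + mean_hit n A (nbr n v West) + mean_hit n A (nbr n v North)
      + mean_hit n A (nbr n v South)"
      using height_bounds[OF first_visit_in_Cyl[OF v(1)]]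
      by (subst first_step) (auto simp: step)
    then show ?thesis by (simp add: mean_hit_def)
  qed
qed (use A n mean_hit_bounds in auto)

text \<open>The bound on the starting column is carried along because \<open>walk_space\<close>
  lives on all natural numbers, and heights are bounded only for walks inside the cylinder.\<close>

lemma AE_first_visit:
  assumes A: "A \<subseteq> Cyl n" "A \<noteq> {}" and j: "j \<le> n" and n: "n > 0"
  shows "AE z in walk_space n. first_visit n A (fst z, j) (snd z) \<in> A \<and> fst z < n"
proof -
  interpret M: prob_space moves by (rule prob_space_moves)
  interpret P: pair_sigma_finite "measure_pmf (pmf_of_set {..<n})" moves ..
  have ae: "AE x in measure_pmf (pmf_of_set {..<n}). AE \<omega> in moves.
      first_visit n A (x, j) \<omega> \<in> A \<and> x < n"
  proof (unfold AE_measure_pmf_iff, rule ballI)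
    fix x assume "x \<in> set_pmf (pmf_of_set {..<n})"
    then have x: "x < n" using n by (simp add: set_pmf_of_set lessThan_empty_iff)
    then have "(x, j) \<in> Cyl n" using j by (simp add: Cyl_def)
    from AE_visits[OF A this] show "AE \<omega> in moves. first_visit n A (x, j) \<omega> \<in> A \<and> x < n"
      by eventually_elim (use x first_visit_in in blast)
  qed
  show ?thesis unfolding walk_space_def
  proof (rule P.AE_pair_measure)
    have [measurable]: "(\<lambda>z. first_visit n A (fst z, j) (snd z)) \<in>
       measurable (measure_pmf (pmf_of_set {..<n}) \<Otimes>\<^sub>M moves) (count_space UNIV)"
      using measurable_first_visit_start unfolding walk_space_def .
    show "{z \<in> space (measure_pmf (pmf_of_set {..<n}) \<Otimes>\<^sub>M moves).
       first_visit n A (fst z, j) (snd z) \<in> A \<and> fst z < n} \<in> sets (measure_pmf (pmf_of_set {..<n}) \<Otimes>\<^sub>M moves)"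
      by measurable
    show "AE x in measure_pmf (pmf_of_set {..<n}). AE y in moves. first_visit n A (fst (x, y), j) (snd (x, y)) \<in> A \<and> fst (x, y) < n"
      using ae by simp
  qed
qed

lemma walk_space_mean_height:
  assumes j: "j \<le> n" and n: "n > 0"
  shows "integrable (walk_space n) (\<lambda>z. height n (first_visit n A (fst z, j) (snd z)))" (is ?int)
    and "(\<integral>z. height n (first_visit n A (fst z, j) (snd z)) \<partial>walk_space n) = (\<Sum>i<n. mean_hit n A (i, j)) / n" (is ?eq)
proof -
  interpret M: prob_space moves by (rule prob_space_moves)
  interpret W: prob_space "walk_space n" by (rule prob_space_walk_space)
  interpret P: pair_sigma_finite "measure_pmf (pmf_of_set {..<n})" moves ..
  \<comment> \<open>Only the column bound is wanted, so the target is the whole cylinder;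
    \<open>A\<close> may be empty here.\<close>
  have "AE z in walk_space n. fst z < n"
    using AE_first_visit[of "Cyl n" n j] j n by (auto simp: Cyl_def lessThan_empty_iff)
  then show i: ?int
  proof (intro W.integrable_const_bound[of _ 1], eventually_elim)
    case (elim z)
    then have "(fst z, j) \<in> Cyl n" using j by (simp add: Cyl_def)
    from height_bounds[OF first_visit_in_Cyl[OF this]] show ?case by simp
  qed measurable
  have "(\<integral>z. height n (first_visit n A (fst z, j) (snd z)) \<partial>walk_space n)
    = (\<integral>x. (\<integral>\<omega>. height n (first_visit n A (x, j) \<omega>) \<partial>moves) \<partial>measure_pmf (pmf_of_set {..<n}))"
    using P.integral_fst'[OF i[unfolded walk_space_def]] unfolding walk_space_def by simp
  also have "\<dots> = (\<Sum>i<n. mean_hit n A (i, j)) / n"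
    using n by (subst integral_pmf_of_set) (auto simp: mean_hit_def lessThan_empty_iff)
  finally show ?eq .
qed

section \<open>Drift of the chain\<close>

lemma exp_le_quadratic:
  fixes x :: real
  assumes "\<bar>x\<bar> \<le> 1"
  shows "exp x \<le> 1 + x + x\<^sup>2"
proof (cases "0 \<le> x")
  case True then show ?thesis using assms by (intro exp_bound) auto
next
  case False
  \<comment> \<open>For negative arguments the inequality is inverted: the quadratic Taylor
    polynomial of \<open>exp y\<close>, times \<open>1 - y + y\<^sup>2\<close>, is at least
    1.\<close>
  define y where "y = - x"
  have y: "0 \<le> y" "y \<le> 1" using False assms by (auto simp: y_def)
  have "1 \<le> (1 + y + y\<^sup>2 / 2) * (1 - y + y\<^sup>2)"
  proof -
    have "(1 + y + y\<^sup>2 / 2) * (1 - y + y\<^sup>2) = 1 + y\<^sup>2 / 2 + y ^ 3 / 2 + y ^ 4 / 2"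
      by (simp add: field_simps power2_eq_square power3_eq_cube power4_eq_xxxx)
    then show ?thesis using y by simp
  qed
  also have "\<dots> \<le> exp y * (1 - y + y\<^sup>2)"
    using y exp_lower_Taylor_quadratic[OF y(1)] by (intro mult_right_mono) auto
  finally have "exp (- y) * 1 \<le> exp (- y) * (exp y * (1 - y + y\<^sup>2))"
    by (intro mult_left_mono) auto
  then show ?thesis by (simp add: y_def mult.assoc[symmetric] exp_add[symmetric])
qed

section \<open>Excess height of the blue set over the slab\<close>

abbreviation blue :: "nat \<Rightarrow> config \<Rightarrow> vertex set" where
  "blue n \<sigma> \<equiv> {v \<in> Cyl n. \<sigma> v = 1}"

abbreviation red :: "nat \<Rightarrow> config \<Rightarrow> vertex set" where
  "red n \<sigma> \<equiv> {v \<in> Cyl n. \<sigma> v = 2}"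

abbreviation slab :: "real \<Rightarrow> nat \<Rightarrow> vertex set" where
  "slab \<alpha> n \<equiv> {v \<in> Cyl n. height n v \<le> \<alpha>}"

definition excess :: "real \<Rightarrow> nat \<Rightarrow> config \<Rightarrow> real" where
  "excess \<alpha> n \<sigma> = (\<Sum>v\<in>sym_diff (blue n \<sigma>) (slab \<alpha> n). \<bar>height n v - \<alpha>\<bar>)"

text \<open>The sign of \<open>height n v - \<alpha>\<close> tells whether \<open>v\<close> lies in
  the slab, so the absolute values resolve and the common part cancels. This makes the excess
  additive in the blue set.\<close>

lemma excess_eq:
  "excess \<alpha> n \<sigma> = (\<Sum>v\<in>blue n \<sigma>. height n v - \<alpha>) - (\<Sum>v\<in>slab \<alpha> n. height n v - \<alpha>)"
proof -
  let ?h = "\<lambda>v. height n v - \<alpha>"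
  have fin: "finite (blue n \<sigma>)" "finite (slab \<alpha> n)" by simp_all
  have "excess \<alpha> n \<sigma> = (\<Sum>v\<in>blue n \<sigma> - slab \<alpha> n. \<bar>?h v\<bar>) + (\<Sum>v\<in>slab \<alpha> n - blue n \<sigma>. \<bar>?h v\<bar>)"
    unfolding excess_def using fin by (intro sum.union_disjoint) auto
  also have "\<dots> = (\<Sum>v\<in>blue n \<sigma> - slab \<alpha> n. ?h v) + (\<Sum>v\<in>slab \<alpha> n - blue n \<sigma>. - ?h v)"
    by (intro arg_cong2[of _ _ _ _ "(+)"] sum.cong) auto
  also have "\<dots> = (\<Sum>v\<in>blue n \<sigma> - slab \<alpha> n. ?h v) - (\<Sum>v\<in>slab \<alpha> n - blue n \<sigma>. ?h v)"
    by (simp only: sum_negf)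
  also have "\<dots> = (\<Sum>v\<in>blue n \<sigma>. ?h v) - (\<Sum>v\<in>slab \<alpha> n. ?h v)"
    using sum.Int_Diff[OF fin(1), of ?h "slab \<alpha> n"] sum.Int_Diff[OF fin(2), of ?h "blue n \<sigma>"]
    by (simp add: Int_commute)
  finally show ?thesis .
qed

text \<open>One vertex enters the blue set and one leaves, so \<alpha> cancels. The case
  \<open>v' = v\<close>, where the second walk undoes the first, is included.\<close>

lemma excess_swap:
  assumes "v \<in> Cyl n" "\<sigma> v \<noteq> 1" "v' \<in> Cyl n" "(\<sigma>(v := 1)) v' = 1"
  shows "excess \<alpha> n (\<sigma>(v := 1, v' := 2)) = excess \<alpha> n \<sigma> + (height n v - height n v')"
proof -
  have "blue n (\<sigma>(v := 1, v' := 2)) = insert v (blue n \<sigma>) - {v'}"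
    using assms(1) by auto
  moreover have "v' \<in> insert v (blue n \<sigma>)" using assms by (auto split: if_splits)
  moreover have "v \<notin> blue n \<sigma>" using assms by simp
  moreover have "finite (blue n \<sigma>)" by simp
  ultimately show ?thesis unfolding excess_eq by (simp only: sum_diff1 finite_insert sum.insert) simp
qed

lemma excess_le_card:
  assumes "0 < \<alpha>" "\<alpha> < 1"
  shows "excess \<alpha> n \<sigma> \<le> card (sym_diff (blue n \<sigma>) (slab \<alpha> n))"
proof -
  have "excess \<alpha> n \<sigma> \<le> (\<Sum>v\<in>sym_diff (blue n \<sigma>) (slab \<alpha> n). 1)"
    unfolding excess_def
  proof (rule sum_mono)
    fix v assume "v \<in> sym_diff (blue n \<sigma>) (slab \<alpha> n)"
    then have "v \<in> Cyl n" by auto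
    from height_bounds[OF this] assms show "\<bar>height n v - \<alpha>\<bar> \<le> 1" by linarith
  qed
  then show ?thesis by simp
qed

lemma card_nat_open_interval:
  fixes a b :: real
  assumes "a < b"
  shows "finite {j :: nat. a < j \<and> j < b}" "card {j :: nat. a < j \<and> j < b} \<le> b - a + 1"
proof -
  have sub: "int ` {j :: nat. a < j \<and> j < b} \<subseteq> {\<lfloor>a\<rfloor> <..< \<lceil>b\<rceil>}"
    by (auto simp: floor_less_iff less_ceiling_iff)
  then show fin: "finite {j :: nat. a < j \<and> j < b}"
    using finite_imageD[OF finite_subset[OF sub]] by simp
  have "card {j :: nat. a < j \<and> j < b} = card (int ` {j :: nat. a < j \<and> j < b})"
    by (simp add: card_image)
  also have "\<dots> \<le> card {\<lfloor>a\<rfloor> <..< \<lceil>b\<rceil>}" using sub by (intro card_mono) auto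
  also have "\<dots> = nat (\<lceil>b\<rceil> - \<lfloor>a\<rfloor> - 1)" by simp
  finally show "card {j :: nat. a < j \<and> j < b} \<le> b - a + 1" using assms by linarith
qed

lemma card_near_level:
  assumes "n > 0" "\<rho> > 0"
  shows "card {v \<in> Cyl n. \<bar>height n v - \<alpha>\<bar> < \<rho>} \<le> 2 * \<rho> * (real n)\<^sup>2 + n"
proof -
  let ?J = "{j :: nat. (\<alpha> - \<rho>) * n < j \<and> j < (\<alpha> + \<rho>) * n}"
  have ab: "(\<alpha> - \<rho>) * n < (\<alpha> + \<rho>) * n" using assms by (intro mult_strict_right_mono) auto
  have "{v \<in> Cyl n. \<bar>height n v - \<alpha>\<bar> < \<rho>} \<subseteq> {..<n} \<times> ?J"
    using assms by (auto simp: Cyl_def height_def abs_less_iff field_simps)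
  then have "card {v \<in> Cyl n. \<bar>height n v - \<alpha>\<bar> < \<rho>} \<le> card ({..<n} \<times> ?J)"
    using card_nat_open_interval(1)[OF ab] by (intro card_mono) auto
  then have "real (card {v \<in> Cyl n. \<bar>height n v - \<alpha>\<bar> < \<rho>}) \<le> n * card ?J"
    by (simp add: card_cartesian_product flip: of_nat_mult)
  also have "\<dots> \<le> real n * ((\<alpha> + \<rho>) * n - (\<alpha> - \<rho>) * n + 1)"
    using card_nat_open_interval(2)[OF ab] unfolding of_nat_mult by (intro mult_left_mono) auto
  finally show ?thesis by (simp add: power2_eq_square algebra_simps)
qed

text \<open>Few vertices lie within \<rho> of the level \<alpha>; every other vertex of the
  symmetric difference contributes at least \<rho>.\<close>

lemma excess_ge:
  assumes n: "n > 0" and \<rho>: "\<rho> > 0"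
  shows "\<rho> * (card (sym_diff (blue n \<sigma>) (slab \<alpha> n)) - 2 * \<rho> * (real n)\<^sup>2 - n) \<le> excess \<alpha> n \<sigma>"
proof -
  let ?D = "sym_diff (blue n \<sigma>) (slab \<alpha> n)" and ?N = "{v \<in> Cyl n. \<bar>height n v - \<alpha>\<bar> < \<rho>}"
  have "real (card ?D) - card ?N \<le> card (?D - ?N)"
    using diff_card_le_card_Diff[of ?N ?D] by simp
  then have "\<rho> * (card ?D - 2 * \<rho> * (real n)\<^sup>2 - n) \<le> \<rho> * card (?D - ?N)"
    using \<rho> card_near_level[OF n \<rho>, of \<alpha>] by (intro mult_left_mono) auto
  also have "\<dots> = (\<Sum>v\<in>?D - ?N. \<rho>)" by simp
  also have "\<dots> \<le> (\<Sum>v\<in>?D - ?N. \<bar>height n v - \<alpha>\<bar>)"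
    by (intro sum_mono) auto
  also have "\<dots> \<le> excess \<alpha> n \<sigma>"
    unfolding excess_def by (intro sum_mono2) auto
  finally show ?thesis .
qed

lemma Cyl_minus_red: "\<sigma> \<in> Cyl n \<rightarrow> {1, 2} \<Longrightarrow> Cyl n - red n \<sigma> = blue n \<sigma>"
  by fastforce

lemma card_Cyl: "card (Cyl n) = n * (n + 1)"
  by (simp add: Cyl_def card_cartesian_product)

lemma blue_walk_mean_le:
  assumes \<sigma>: "\<sigma> \<in> Cyl n \<rightarrow> {1, 2}" and n: "n > 0" and ne: "red n \<sigma> \<noteq> {}"
  shows "(\<integral>z. height n (first_visit n (red n \<sigma>) (fst z, 0) (snd z)) \<partial>walk_space n) \<le> card (blue n \<sigma>) / (real n)\<^sup>2"
proof -
  interpret stopped_height n "red n \<sigma>" "mean_hit n (red n \<sigma>)"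
    using ne n by (intro stopped_height_mean_hit) auto
  show ?thesis
    using bottom_mean_le n by (simp add: walk_space_mean_height(2) bottom_mean_def Cyl_minus_red[OF \<sigma>])
qed

text \<open>Contrapositive of \<open>near_level_set\<close>: far from the slab the deficit exceeds
  \<eta>^3.\<close>

lemma blue_walk_mean_gap:
  fixes \<alpha> \<eta> :: real
  assumes \<sigma>: "\<sigma> \<in> Cyl n \<rightarrow> {1, 2}" and n: "n > 0" and ne: "red n \<sigma> \<noteq> {}"
    and alpha: "0 < \<alpha>" "\<alpha> < 1" and vol: "\<bar>card (blue n \<sigma>) - \<alpha> * n * (real n + 1)\<bar> \<le> 1"
    and eta: "0 < \<eta>" "\<eta> \<le> 1"
    and far: "8 * \<eta> * (real n)\<^sup>2 + 4 * real n < card (sym_diff (blue n \<sigma>) (slab \<alpha> n))"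
  shows "(\<integral>z. height n (first_visit n (red n \<sigma>) (fst z, 0) (snd z)) \<partial>walk_space n)
    \<le> card (blue n \<sigma>) / (real n)\<^sup>2 - \<eta> ^ 3"
proof -
  interpret stopped_height n "red n \<sigma>" "mean_hit n (red n \<sigma>)"
    using ne n by (intro stopped_height_mean_hit) auto
  have "\<not> card (Cyl n - red n \<sigma>) / (real n)\<^sup>2 - bottom_mean \<le> \<eta> ^ 3"
    using near_level_set[of \<eta> \<alpha>] eta alpha vol far by (auto simp: Cyl_minus_red[OF \<sigma>])
  then show ?thesis
    using n by (simp add: walk_space_mean_height(2) bottom_mean_def Cyl_minus_red[OF \<sigma>])
qed

lemma red_walk_mean_ge:
  assumes \<sigma>: "\<sigma> \<in> Cyl n \<rightarrow> {1, 2}" and n: "n > 0" and ne: "blue n \<sigma> \<noteq> {}"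
  shows "1 - (real n * (real n + 1) - card (blue n \<sigma>)) / (real n)\<^sup>2
    \<le> (\<integral>z. height n (first_visit n (blue n \<sigma>) (fst z, n) (snd z)) \<partial>walk_space n)"
proof -
  interpret stopped_height n "blue n \<sigma>" "mean_hit n (blue n \<sigma>)"
    using ne n by (intro stopped_height_mean_hit) auto
  have "real (card (Cyl n - blue n \<sigma>)) = real (card (Cyl n)) - card (blue n \<sigma>)"
    by (subst card_Diff_subset) (auto intro!: of_nat_diff card_mono)
  then have "real (card (Cyl n - blue n \<sigma>)) = real n * (real n + 1) - card (blue n \<sigma>)"
    by (simp add: card_Cyl algebra_simps)
  from top_mean_ge[unfolded this] n show ?thesis
    by (simp add: walk_space_mean_height(2))
qed

section \<open>One step of the chain\<close>

locale erosion_step =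
  fixes n :: nat and \<sigma> :: config
  assumes n_pos: "n > 0" and coloring: "\<sigma> \<in> Cyl n \<rightarrow> {1, 2}" and red_nonempty: "red n \<sigma> \<noteq> {}"
begin

abbreviation "W \<equiv> walk_space n"
abbreviation "WW \<equiv> walk_space n \<Otimes>\<^sub>M walk_space n"

definition hit1 :: "nat \<times> move stream \<Rightarrow> vertex" where
  "hit1 z = first_visit n (red n \<sigma>) (fst z, 0) (snd z)"

text \<open>The vertex recolored first is a parameter, so that the second walk can be averaged with
  it held fixed.\<close>

definition hit2 :: "vertex \<Rightarrow> nat \<times> move stream \<Rightarrow> vertex" where
  "hit2 v z = first_visit n (blue n (\<sigma>(v := 1))) (fst z, n) (snd z)"

text \<open>By \<open>excess_swap\<close> this is the expected change of the excess in one
  step.\<close>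

definition drift :: real where
  "drift = (\<integral>z. height n (hit1 (fst z)) - height n (hit2 (hit1 (fst z)) (snd z)) \<partial>WW)"

sublocale W: prob_space W by (rule prob_space_walk_space)
sublocale P: pair_prob_space W W ..

lemma step_eq: "red_step n (blue_step n \<sigma> z1) z2 = \<sigma>(hit1 z1 := 1, hit2 (hit1 z1) z2 := 2)"
  by (simp add: red_step_def blue_step_def hit1_def hit2_def case_prod_beta)

lemma measurable_hit1 [measurable]: "hit1 \<in> measurable W (count_space UNIV)"
  unfolding hit1_def by measurable

lemma measurable_hit2 [measurable]: "hit2 v \<in> measurable W (count_space UNIV)"
  unfolding hit2_def by measurable

lemma measurable_hit12 [measurable]:
  "(\<lambda>z. hit2 (hit1 (fst z)) (snd z)) \<in> measurable WW (count_space UNIV)"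
  by (rule measurable_compose_countable[where f = "\<lambda>v z. hit2 v (snd z)" and g = "\<lambda>z. hit1 (fst z)"])
     measurable

text \<open>Configurations form an uncountable type, but the new one depends only on two vertices,
  which take countably many values.\<close>

lemma measurable_step:
  "(\<lambda>z. \<sigma>(hit1 (fst z) := 1, hit2 (hit1 (fst z)) (snd z) := 2)) \<in> measurable WW (count_space UNIV)"
proof (rule measurable_compose_countable[where f = "\<lambda>v z. \<sigma>(hit1 (fst z) := 1, v := 2)" and g = "\<lambda>z. hit2 (hit1 (fst z)) (snd z)"])
  fix v
  show "(\<lambda>z. \<sigma>(hit1 (fst z) := 1, v := 2)) \<in> measurable WW (count_space UNIV)"
    by (rule measurable_compose[where g = "\<lambda>a. \<sigma>(a := 1, v := 2)" and N = "count_space UNIV"]) measurable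
qed measurable

lemma recolored:
  assumes "v \<in> red n \<sigma>"
  shows "\<sigma>(v := 1) \<in> Cyl n \<rightarrow> {1, 2}" "blue n (\<sigma>(v := 1)) \<noteq> {}" "card (blue n (\<sigma>(v := 1))) = card (blue n \<sigma>) + 1"
proof -
  have "blue n (\<sigma>(v := 1)) = insert v (blue n \<sigma>)" "v \<notin> blue n \<sigma>" using assms by auto
  then show "card (blue n (\<sigma>(v := 1))) = card (blue n \<sigma>) + 1" "blue n (\<sigma>(v := 1)) \<noteq> {}"
    by (simp_all only: card_insert_disjoint[of "blue n \<sigma>"] finite_Collect_conjI finite_Cyl) auto
qed (use coloring in fastforce)

lemma AE_hit1: "AE z in W. hit1 z \<in> red n \<sigma> \<and> fst z < n"
  unfolding hit1_def using red_nonempty n_pos by (intro AE_first_visit) auto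

lemma AE_hits: "AE z in WW. hit1 (fst z) \<in> red n \<sigma> \<and> hit2 (hit1 (fst z)) (snd z) \<in> blue n (\<sigma>(hit1 (fst z) := 1))"
proof (rule P.AE_pair_measure)
  have "Measurable.pred WW (\<lambda>z. hit1 (fst z) \<in> red n \<sigma> \<and>
      hit2 (hit1 (fst z)) (snd z) \<in> blue n (\<sigma>(hit1 (fst z) := 1)))"
    by (rule measurable_compose_countable[where g = "\<lambda>z. hit1 (fst z)"
        and f = "\<lambda>v z. v \<in> red n \<sigma> \<and> hit2 v (snd z) \<in> blue n (\<sigma>(v := 1))"]) measurable
  then show "{z \<in> space WW. hit1 (fst z) \<in> red n \<sigma> \<and> hit2 (hit1 (fst z)) (snd z) \<in> blue n (\<sigma>(hit1 (fst z) := 1))} \<in> sets WW"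
    by (rule predE)
  show "AE x in W. AE y in W. hit1 (fst (x, y)) \<in> red n \<sigma> \<and> hit2 (hit1 (fst (x, y))) (snd (x, y)) \<in> blue n (\<sigma>(hit1 (fst (x, y)) := 1))"
    using AE_hit1
  proof eventually_elim
    case (elim x)
    have "AE y in W. hit2 (hit1 x) y \<in> blue n (\<sigma>(hit1 x := 1)) \<and> fst y < n"
      unfolding hit2_def
      by (rule AE_first_visit[OF _ recolored(2)[OF conjunct1[OF elim]] order_refl n_pos]) blast
    then show ?case by eventually_elim (use elim in simp)
  qed
qed

lemma AE_bounds: "AE z in WW. height n (hit1 (fst z)) \<in> {0..1} \<and> height n (hit2 (hit1 (fst z)) (snd z)) \<in> {0..1}"
  using AE_hits by eventually_elim (auto intro!: height_bounds)

lemma integrable_heights: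
  "integrable WW (\<lambda>z. height n (hit1 (fst z)))" "integrable WW (\<lambda>z. height n (hit2 (hit1 (fst z)) (snd z)))"
proof -
  have [measurable]: "height n \<in> borel_measurable (count_space UNIV)" by simp
  show "integrable WW (\<lambda>z. height n (hit1 (fst z)))"
    using AE_bounds by (intro P.P.integrable_const_bound[of _ 1]) auto
  show "integrable WW (\<lambda>z. height n (hit2 (hit1 (fst z)) (snd z)))"
    using AE_bounds by (intro P.P.integrable_const_bound[of _ 1]) auto
qed

text \<open>The lower bound for the red walk holds for every outcome of the blue walk, hence on
  average. The term \<open>1 / n\<close> arises because the cylinder has n^2 + n vertices. The blue
  mean stays explicit, so that either of its two bounds can be inserted.\<close>

lemma drift_le: "drift \<le> (\<integral>z. height n (hit1 z) \<partial>W) - card (blue n \<sigma>) / (real n)\<^sup>2 + 1 / n"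
proof -
  have 1: "(\<integral>z. height n (hit1 (fst z)) \<partial>WW) = (\<integral>z. height n (hit1 z) \<partial>W)"
    using P.integral_fst'[OF integrable_heights(1)] by (simp add: W.prob_space)
  have "(\<integral>x. (\<integral>y. height n (hit2 (hit1 x) y) \<partial>W) \<partial>W) \<ge> 1 - (real n * (real n + 1) - (card (blue n \<sigma>) + 1)) / (real n)\<^sup>2"
  proof (rule W.integral_ge_const)
    show "integrable W (\<lambda>x. \<integral>y. height n (hit2 (hit1 x) y) \<partial>W)"
      using P.integrable_fst'[OF integrable_heights(2)] by simp
    show "AE x in W. 1 - (real n * (real n + 1) - (card (blue n \<sigma>) + 1)) / (real n)\<^sup>2 \<le> (\<integral>y. height n (hit2 (hit1 x) y) \<partial>W)"
      using AE_hit1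
    proof eventually_elim
      case (elim x)
      then have "hit1 x \<in> red n \<sigma>" by simp
      from red_walk_mean_ge[OF recolored(1)[OF this] n_pos recolored(2)[OF this]] recolored(3)[OF this]
      show ?case by (simp add: hit2_def)
    qed
  qed
  then have 2: "1 - (real n * (real n + 1) - (card (blue n \<sigma>) + 1)) / (real n)\<^sup>2 \<le> (\<integral>z. height n (hit2 (hit1 (fst z)) (snd z)) \<partial>WW)"
    using P.integral_fst'[OF integrable_heights(2)] by simp
  have "(real n * (real n + 1) - (card (blue n \<sigma>) + 1)) / (real n)\<^sup>2 \<le> 1 + 1 / n - card (blue n \<sigma>) / (real n)\<^sup>2"
    using n_pos by (simp add: field_simps power2_eq_square)
  then show ?thesis using 2 unfolding drift_def
    by (subst Bochner_Integration.integral_diff[OF integrable_heights]) (simp add: 1)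
qed

text \<open>The excess changes by at most 1, so expanding the exponential to second order costs at
  most \<theta>^2. At most one term of the sum is nonzero for each outcome, which permits any finite
  \<open>S\<close>.\<close>

lemma exp_excess_step:
  assumes lam: "0 \<le> \<theta>" "\<theta> \<le> 1" and fin: "finite S"
  shows "(\<Sum>\<tau>\<in>S. trans_prob n \<sigma> \<tau> * exp (\<theta> * excess \<alpha> n \<tau>))
    \<le> exp (\<theta> * excess \<alpha> n \<sigma>) * (1 + \<theta> * drift + \<theta>\<^sup>2)"
proof -
  define new where "new z = \<sigma>(hit1 (fst z) := 1, hit2 (hit1 (fst z)) (snd z) := 2)" for z
  define d where "d z = height n (hit1 (fst z)) - height n (hit2 (hit1 (fst z)) (snd z))" for z
  let ?E = "\<lambda>\<tau>. {z \<in> space WW. new z = \<tau>}"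
  have [measurable]: "new \<in> measurable WW (count_space UNIV)"
    unfolding new_def using measurable_step by simp
  have sets: "?E \<tau> \<in> sets WW" for \<tau> by measurable
  have "(\<Sum>\<tau>\<in>S. trans_prob n \<sigma> \<tau> * exp (\<theta> * excess \<alpha> n \<tau>))
     = (\<Sum>\<tau>\<in>S. \<integral>z. indicator (?E \<tau>) z * exp (\<theta> * excess \<alpha> n \<tau>) \<partial>WW)"
    using sets by (intro sum.cong) (simp_all add: trans_prob_def step_eq new_def)
  also have "\<dots> = (\<integral>z. (\<Sum>\<tau>\<in>S. indicator (?E \<tau>) z * exp (\<theta> * excess \<alpha> n \<tau>)) \<partial>WW)"
    using sets by (intro Bochner_Integration.integral_sum[symmetric])
      (auto intro!: integrable_mult_left simp: P.P.emeasure_eq_measure)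
  also have "\<dots> \<le> (\<integral>z. exp (\<theta> * excess \<alpha> n \<sigma>) * (1 + \<theta> * d z + \<theta>\<^sup>2) \<partial>WW)"
  proof (rule integral_mono_AE)
    show "integrable WW (\<lambda>z. \<Sum>\<tau>\<in>S. indicator (?E \<tau>) z * exp (\<theta> * excess \<alpha> n \<tau>))"
      using sets by (auto intro!: Bochner_Integration.integrable_sum integrable_mult_left simp: P.P.emeasure_eq_measure)
    show "integrable WW (\<lambda>z. exp (\<theta> * excess \<alpha> n \<sigma>) * (1 + \<theta> * d z + \<theta>\<^sup>2))"
      unfolding d_def using integrable_heights by auto
    show "AE z in WW. (\<Sum>\<tau>\<in>S. indicator (?E \<tau>) z * exp (\<theta> * excess \<alpha> n \<tau>))
        \<le> exp (\<theta> * excess \<alpha> n \<sigma>) * (1 + \<theta> * d z + \<theta>\<^sup>2)"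
      using AE_hits AE_bounds
    proof eventually_elim
      case (elim z)
      have "(\<Sum>\<tau>\<in>S. indicator (?E \<tau>) z * exp (\<theta> * excess \<alpha> n \<tau>))
        \<le> (\<Sum>\<tau>\<in>S. if \<tau> = new z then exp (\<theta> * excess \<alpha> n (new z)) else 0)"
        by (intro sum_mono) (auto simp: indicator_def)
      also have "\<dots> \<le> exp (\<theta> * excess \<alpha> n (new z))"
        using fin by (simp add: sum.delta)
      also have "excess \<alpha> n (new z) = excess \<alpha> n \<sigma> + d z"
        unfolding new_def d_def using elim by (intro excess_swap) auto
      also have "exp (\<theta> * (excess \<alpha> n \<sigma> + d z)) = exp (\<theta> * excess \<alpha> n \<sigma>) * exp (\<theta> * d z)"
        by (simp add: distrib_left exp_add)
      also have "exp (\<theta> * d z) \<le> 1 + \<theta> * d z + (\<theta> * d z)\<^sup>2"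
      proof (rule exp_le_quadratic)
        have "\<bar>\<theta>\<bar> * \<bar>d z\<bar> \<le> 1 * 1" using lam elim by (intro mult_mono) (auto simp: d_def)
        then show "\<bar>\<theta> * d z\<bar> \<le> 1" by (simp add: abs_mult)
      qed
      also have "(\<theta> * d z)\<^sup>2 \<le> \<theta>\<^sup>2"
      proof -
        have "\<bar>d z\<bar> \<le> 1" using elim by (auto simp: d_def)
        then have "(d z)\<^sup>2 \<le> 1" by (simp add: abs_square_le_1)
        then show ?thesis by (simp add: power_mult_distrib mult_left_le)
      qed
      finally show ?case by simp
    qed
  qed
  also have "\<dots> = exp (\<theta> * excess \<alpha> n \<sigma>) * (1 + \<theta> * drift + \<theta>\<^sup>2)"
    unfolding drift_def d_def[symmetric]
    using integrable_heights by (simp add: d_def P.P.prob_space)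
  finally show ?thesis .
qed

end

section \<open>The stationary distribution\<close>

lemma finite_Omega: "finite (Omega \<alpha> n)"
proof (rule finite_subset)
  show "Omega \<alpha> n \<subseteq> Cyl n \<rightarrow>\<^sub>E {1, 2}" by (auto simp: Omega_def)
  show "finite (Cyl n \<rightarrow>\<^sub>E {1, 2 :: nat})" by (intro finite_PiE) auto
qed

lemma Omega_volume:
  assumes "\<sigma> \<in> Omega \<alpha> n"
  shows "\<bar>real (card (blue n \<sigma>)) - \<alpha> * n * (real n + 1)\<bar> \<le> 1"
proof -
  have "int (card (blue n \<sigma>)) = \<lfloor>\<alpha> * real n * (real n + 1)\<rfloor>"
    using assms by (simp add: Omega_def)
  then have "real (card (blue n \<sigma>)) = \<lfloor>\<alpha> * real n * (real n + 1)\<rfloor>"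
    by (metis of_int_of_nat_eq)
  moreover have "real (n + 1) = real n + 1" by simp
  ultimately show ?thesis by (simp only:) linarith
qed

lemma erosion_step_Omega:
  assumes alpha: "\<alpha> < 1" and n: "n > 0" and \<sigma>: "\<sigma> \<in> Omega \<alpha> n"
  shows "erosion_step n \<sigma>"
proof
  show col: "\<sigma> \<in> Cyl n \<rightarrow> {1, 2}" using \<sigma> by (auto simp: Omega_def PiE_def)
  show "red n \<sigma> \<noteq> {}"
  proof
    assume "red n \<sigma> = {}"
    then have "blue n \<sigma> = Cyl n" using Cyl_minus_red[OF col] unfolding \<open>red n \<sigma> = {}\<close> by simp
    then have "\<lfloor>\<alpha> * real n * (real n + 1)\<rfloor> = int (n * (n + 1))"
      using \<sigma> unfolding Omega_def mem_Collect_eq by (simp only: card_Cyl)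
    then have "real (n * (n + 1)) \<le> \<alpha> * (real n * (real n + 1))"
      by (metis mult.assoc of_int_floor_le of_int_of_nat_eq)
    moreover have "\<alpha> * (real n * (real n + 1)) < 1 * (real n * (real n + 1))"
      using alpha n by (intro mult_strict_right_mono mult_pos_pos) auto
    ultimately show False by (simp add: algebra_simps)
  qed
qed (rule n)

text \<open>A Foster-Lyapunov condition. Far from the slab the drift is at most -\<eta>^3/2, and the
  rate \<eta>^3/4 turns this into -\<eta>^6/8 + \<eta>^6/16. Near the slab the excess itself is
  bounded.\<close>

lemma exp_excess_contracts:
  fixes \<alpha> \<eta> :: real
  assumes alpha: "0 < \<alpha>" "\<alpha> < 1" and eta: "0 < \<eta>" "\<eta> \<le> 1" and n: "2 \<le> \<eta> ^ 3 * n"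
    and \<sigma>: "\<sigma> \<in> Omega \<alpha> n"
  shows "(\<Sum>\<tau>\<in>Omega \<alpha> n. trans_prob n \<sigma> \<tau> * exp (\<eta> ^ 3 / 4 * excess \<alpha> n \<tau>))
    \<le> (1 - \<eta> ^ 6 / 16) * exp (\<eta> ^ 3 / 4 * excess \<alpha> n \<sigma>) + 3 * exp (\<eta> ^ 3 / 4 * (8 * \<eta> * (real n)\<^sup>2 + 4 * real n))"
proof -
  let ?t = "\<eta> ^ 3 / 4" and ?L = "8 * \<eta> * (real n)\<^sup>2 + 4 * real n"
  have n_pos: "n > 0" using n by (cases n) auto
  interpret erosion_step n \<sigma> by (rule erosion_step_Omega[OF alpha(2) n_pos \<sigma>])
  have e3: "0 < \<eta> ^ 3" "\<eta> ^ 3 \<le> 1" using eta by (auto intro: power_le_one)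
  \<comment> \<open>The error \<open>1 / n\<close> in the drift uses up at most half of the gap
    \<eta>^3.\<close>
  have inv_n: "1 / n \<le> \<eta> ^ 3 / 2" using n n_pos by (simp add: field_simps)
  have e6: "\<eta> ^ 6 = \<eta> ^ 3 * \<eta> ^ 3" by (simp flip: power_add)
  have mono: "(\<Sum>\<tau>\<in>Omega \<alpha> n. trans_prob n \<sigma> \<tau> * exp (?t * excess \<alpha> n \<tau>))
    \<le> exp (?t * excess \<alpha> n \<sigma>) * (1 + ?t * drift + ?t\<^sup>2)"
    using e3 by (intro exp_excess_step finite_Omega) auto
  have e6_le: "\<eta> ^ 6 \<le> 1" using eta by (intro power_le_one) auto
  show ?thesis
  proof (cases "?L < card (sym_diff (blue n \<sigma>) (slab \<alpha> n))")
    case True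
    have "drift \<le> - (\<eta> ^ 3) / 2"
      using blue_walk_mean_gap[OF coloring n_pos red_nonempty alpha Omega_volume[OF \<sigma>] eta True] drift_le inv_n
      by (simp add: hit1_def)
    then have "?t * drift \<le> ?t * (- (\<eta> ^ 3) / 2)" using e3 by (intro mult_left_mono) auto
    also have "\<dots> = - (\<eta> ^ 6) / 8" unfolding e6 by simp
    finally have "?t * drift \<le> - (\<eta> ^ 6) / 8" .
    moreover have "?t\<^sup>2 = \<eta> ^ 6 / 16" unfolding e6 power2_eq_square by simp
    ultimately have "1 + ?t * drift + ?t\<^sup>2 \<le> 1 - \<eta> ^ 6 / 16" by linarith
    then have "exp (?t * excess \<alpha> n \<sigma>) * (1 + ?t * drift + ?t\<^sup>2) \<le> exp (?t * excess \<alpha> n \<sigma>) * (1 - \<eta> ^ 6 / 16)"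
      by (intro mult_left_mono) auto
    moreover have "0 < exp (?t * (8 * \<eta> * (real n)\<^sup>2 + 4 * real n))" by simp
    ultimately show ?thesis using mono unfolding mult.commute[of _ "exp (?t * excess \<alpha> n \<sigma>)"] by linarith
  next
    case False
    \<comment> \<open>The drift may be positive here; the factor
      \<open>1 + ?t * drift + ?t\<^sup>2\<close> is bounded crudely by 3.\<close>
    have "drift \<le> 1"
      using blue_walk_mean_le[OF coloring n_pos red_nonempty] drift_le inv_n e3 by (simp add: hit1_def)
    then have "?t * drift \<le> ?t * 1" using e3 by (intro mult_left_mono) auto
    then have "?t * drift \<le> 1" using e3 by linarith
    moreover have "?t\<^sup>2 \<le> 1" using e3 by (intro power_le_one) auto
    ultimately have "exp (?t * excess \<alpha> n \<sigma>) * (1 + ?t * drift + ?t\<^sup>2) \<le> exp (?t * excess \<alpha> n \<sigma>) * 3"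
      by (intro mult_left_mono) auto
    also have "\<dots> \<le> exp (?t * ?L) * 3"
      using False excess_le_card[OF alpha, of n \<sigma>] e3 by (intro mult_right_mono) auto
    finally have "(\<Sum>\<tau>\<in>Omega \<alpha> n. trans_prob n \<sigma> \<tau> * exp (?t * excess \<alpha> n \<tau>)) \<le> 3 * exp (?t * ?L)"
      using mono by simp
    moreover have "0 \<le> (1 - \<eta> ^ 6 / 16) * exp (?t * excess \<alpha> n \<sigma>)" using e6_le by simp
    ultimately show ?thesis by linarith
  qed
qed

text \<open>Average the one-step inequality over \<pi>: by stationarity the left side becomes the
  mean of \<open>F\<close>, and the part with \<open>1 - \<kappa>\<close> is absorbed.\<close>

lemma stationary_drift_bound:
  assumes stat: "stationary \<alpha> n \<pi>"
    and step: "\<And>\<sigma>. \<sigma> \<in> Omega \<alpha> n \<Longrightarrow> (\<Sum>\<tau>\<in>Omega \<alpha> n. trans_prob n \<sigma> \<tau> * F \<tau>) \<le> (1 - \<kappa>) * F \<sigma> + b"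
  shows "\<kappa> * (\<Sum>\<sigma>\<in>Omega \<alpha> n. pmf \<pi> \<sigma> * F \<sigma>) \<le> b"
proof -
  let ?O = "Omega \<alpha> n"
  have total: "(\<Sum>\<sigma>\<in>?O. pmf \<pi> \<sigma>) = 1"
    using stat sum_pmf_eq_1[OF finite_Omega] unfolding stationary_def by blast
  have "(\<Sum>\<tau>\<in>?O. pmf \<pi> \<tau> * F \<tau>) = (\<Sum>\<tau>\<in>?O. (\<Sum>\<sigma>\<in>?O. pmf \<pi> \<sigma> * trans_prob n \<sigma> \<tau>) * F \<tau>)"
    using stat unfolding stationary_def by (intro sum.cong) auto
  also have "\<dots> = (\<Sum>\<sigma>\<in>?O. pmf \<pi> \<sigma> * (\<Sum>\<tau>\<in>?O. trans_prob n \<sigma> \<tau> * F \<tau>))"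
    unfolding sum_distrib_left sum_distrib_right by (subst sum.swap) (simp add: mult.assoc)
  also have "\<dots> \<le> (\<Sum>\<sigma>\<in>?O. pmf \<pi> \<sigma> * ((1 - \<kappa>) * F \<sigma> + b))"
    by (intro sum_mono mult_left_mono step) auto
  also have "\<dots> = (1 - \<kappa>) * (\<Sum>\<sigma>\<in>?O. pmf \<pi> \<sigma> * F \<sigma>) + b * (\<Sum>\<sigma>\<in>?O. pmf \<pi> \<sigma>)"
    unfolding sum_distrib_left sum.distrib[symmetric] by (intro sum.cong) (simp_all add: algebra_simps)
  finally show ?thesis by (simp add: total algebra_simps)
qed

theorem theorem4:
  fixes \<alpha> \<epsilon> :: real
  assumes "0 < \<alpha>" and "\<alpha> < 1" and "0 < \<epsilon>"
  shows "\<exists>c>0. \<forall>\<^sub>F n in sequentially. \<forall>\<pi>. stationary \<alpha> n \<pi> \<longrightarrow>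
           measure_pmf.prob \<pi> (good \<epsilon> \<alpha> n) \<ge> 1 - exp (- (c * real n))"
proof (intro exI[of _ "1::real"] conjI)
  \<comment> \<open>With 512, the threshold 8\<eta>n^2 + 4n is at most \<epsilon>^2 n^2 / 32 for
    large n, half of the excess \<epsilon>^2 n^2 / 16 that bad configurations have.\<close>
  define \<eta> where "\<eta> = min 1 (\<epsilon>\<^sup>2 / 512)"
  have eta: "0 < \<eta>" "\<eta> \<le> 1" "\<eta> \<le> \<epsilon>\<^sup>2 / 512" using assms(3) by (auto simp: \<eta>_def)
  define \<kappa> where "\<kappa> = \<eta> ^ 6 / 16"
  define \<theta> where "\<theta> = \<eta> ^ 3 / 4"
  have pos: "0 < \<kappa>" "0 < \<theta>" using eta by (auto simp: \<kappa>_def \<theta>_def)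
  have \<epsilon>2: "0 < \<epsilon>\<^sup>2" using assms(3) by simp
  have "eventually (\<lambda>n::nat. 2 \<le> \<eta> ^ 3 * n) sequentially" using eta by real_asymp
  moreover have "eventually (\<lambda>n::nat. 4 * n \<le> \<epsilon>\<^sup>2 / 64 * (real n)\<^sup>2) sequentially" using \<epsilon>2 by real_asymp
  moreover have "eventually (\<lambda>n::nat. n \<le> \<epsilon> / 4 * (real n)\<^sup>2) sequentially" using assms(3) by real_asymp
  \<comment> \<open>The tail obtained decays exponentially in n^2, which is why the rate 1 serves
    for every \<epsilon>.\<close>
  moreover have "eventually (\<lambda>n::nat. 3 / \<kappa> * exp (- (\<theta> * \<epsilon>\<^sup>2 / 32 * (real n)\<^sup>2)) \<le> exp (- real n)) sequentially"
    using pos \<epsilon>2 by real_asymp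
  ultimately show "\<forall>\<^sub>F n in sequentially. \<forall>\<pi>. stationary \<alpha> n \<pi> \<longrightarrow>
           measure_pmf.prob \<pi> (good \<epsilon> \<alpha> n) \<ge> 1 - exp (- (1 * real n))"
  proof (eventually_elim, intro allI impI)
    fix n :: nat and \<pi>
    assume n1: "2 \<le> \<eta> ^ 3 * n" and n2: "4 * n \<le> \<epsilon>\<^sup>2 / 64 * (real n)\<^sup>2"
      and n3: "n \<le> \<epsilon> / 4 * (real n)\<^sup>2"
      and n4: "3 / \<kappa> * exp (- (\<theta> * \<epsilon>\<^sup>2 / 32 * (real n)\<^sup>2)) \<le> exp (- real n)"
      and stat: "stationary \<alpha> n \<pi>"
    have n_pos: "n > 0" using n1 by (cases n) auto
    let ?O = "Omega \<alpha> n" and ?F = "\<lambda>\<sigma>. exp (\<theta> * excess \<alpha> n \<sigma>)" and ?N = "(real n)\<^sup>2"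
    have "\<eta> * ?N \<le> \<epsilon>\<^sup>2 / 512 * ?N" using eta by (intro mult_right_mono) auto
    then have L: "8 * \<eta> * (real n)\<^sup>2 + 4 * real n \<le> \<epsilon>\<^sup>2 / 32 * ?N" using n2 by simp
    have "\<kappa> * (\<Sum>\<sigma>\<in>?O. pmf \<pi> \<sigma> * ?F \<sigma>) \<le> 3 * exp (\<theta> * (8 * \<eta> * (real n)\<^sup>2 + 4 * real n))"
      using exp_excess_contracts[OF assms(1,2) eta(1,2) n1]
      by (intro stationary_drift_bound[OF stat]) (simp add: \<theta>_def \<kappa>_def)
    also have "\<dots> \<le> 3 * exp (\<theta> * (\<epsilon>\<^sup>2 / 32 * ?N))" using L pos by simp
    finally have EF: "(\<Sum>\<sigma>\<in>?O. pmf \<pi> \<sigma> * ?F \<sigma>) \<le> 3 / \<kappa> * exp (\<theta> * (\<epsilon>\<^sup>2 / 32 * ?N))"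
      using pos by (simp add: field_simps)
    \<comment> \<open>Take \<rho> = \<epsilon>/4 in \<open>excess_ge\<close>: of more than
      \<epsilon>n^2 vertices at least \<epsilon>n^2/4 remain, each weighing at least
      \<epsilon>/4.\<close>
    have bad: "exp (\<theta> * (\<epsilon>\<^sup>2 / 16 * ?N)) \<le> ?F \<sigma>" if "\<sigma> \<in> ?O - good \<epsilon> \<alpha> n" for \<sigma>
    proof -
      have "\<epsilon> * ?N < card (sym_diff (blue n \<sigma>) (slab \<alpha> n))" using that by (auto simp: good_def)
      then have "\<epsilon> / 4 * (\<epsilon> / 4 * ?N) \<le> \<epsilon> / 4 * (card (sym_diff (blue n \<sigma>) (slab \<alpha> n)) - 2 * (\<epsilon> / 4) * ?N - n)"
        using n3 assms(3) by (intro mult_left_mono) auto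
      also have "\<dots> \<le> excess \<alpha> n \<sigma>" using assms(3) by (intro excess_ge n_pos) auto
      finally show ?thesis using pos by (simp add: power2_eq_square mult_ac)
    qed
    let ?B = "?O - good \<epsilon> \<alpha> n"
    \<comment> \<open>Markov's inequality for the exponential of the excess.\<close>
    have "measure_pmf.prob \<pi> ?B * exp (\<theta> * (\<epsilon>\<^sup>2 / 16 * ?N)) = (\<Sum>\<sigma>\<in>?B. pmf \<pi> \<sigma> * exp (\<theta> * (\<epsilon>\<^sup>2 / 16 * ?N)))"
      using finite_Omega by (simp add: measure_measure_pmf_finite sum_distrib_right)
    also have "\<dots> \<le> (\<Sum>\<sigma>\<in>?B. pmf \<pi> \<sigma> * ?F \<sigma>)"
      by (intro sum_mono mult_left_mono bad) auto
    also have "\<dots> \<le> (\<Sum>\<sigma>\<in>?O. pmf \<pi> \<sigma> * ?F \<sigma>)"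
      using finite_Omega by (intro sum_mono2) auto
    also note EF
    also have "3 / \<kappa> * exp (\<theta> * (\<epsilon>\<^sup>2 / 32 * ?N))
      = 3 / \<kappa> * exp (- (\<theta> * \<epsilon>\<^sup>2 / 32 * ?N)) * exp (\<theta> * (\<epsilon>\<^sup>2 / 16 * ?N))"
      by (simp add: mult.assoc flip: exp_add)
    finally have "measure_pmf.prob \<pi> ?B \<le> 3 / \<kappa> * exp (- (\<theta> * \<epsilon>\<^sup>2 / 32 * ?N))"
      by (rule mult_right_le_imp_le) simp
    also note n4
    finally have "measure_pmf.prob \<pi> ?B \<le> exp (- real n)" .
    moreover have "measure_pmf.prob \<pi> ?B = 1 - measure_pmf.prob \<pi> (good \<epsilon> \<alpha> n)"
    proof -
      have "good \<epsilon> \<alpha> n \<subseteq> ?O" by (auto simp: good_def)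
      moreover have "measure_pmf.prob \<pi> ?O = 1"
        using stat unfolding stationary_def by (simp add: measure_pmf.prob_eq_1 AE_measure_pmf_iff subset_iff)
      ultimately show ?thesis by (simp add: measure_pmf.finite_measure_Diff)
    qed
    ultimately show "1 - exp (- (1 * real n)) \<le> measure_pmf.prob \<pi> (good \<epsilon> \<alpha> n)" by simp
  qed
qed simp

end
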